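(* Let $d=2$, let $X$ be the simplicial set (a triangulated torus, dual to $K_{3,3}$) described in the context, and let $\gamma:X_2\to\mathbb{Z}_2$ be a normalized $2$-cocycle with class $[\gamma]\in H^2(X,\mathbb{Z}_2)\cong\mathbb{Z}_2$. Then $$\pi_1(\mathbb{Z}_2,X_\gamma)\cong\begin{cases}\mathbb{Z}_2^5&[\gamma]=0\\ D_8\ast D_8&[\gamma]=1,\end{cases}$$ where $D_8\ast D_8$ is the central product of two dihedral groups of order $8$ (identifying their centers).
   Context: $X$ is the simplicial set with vertices $A,B,C$; nondegenerate edges (source$\to$target, where $d_1$ is the source and $d_0$ the target) $z_1,t_1,s_1:A\to B$; $x,y:B\to B$; $t_2,s_2,z_3:B\to C$; $z_2:A\to C$; and six nondegenerate $2$-simplices $\sigma_1,\dots,\sigma_6$ with faces $(d_2,d_0,d_1)$ given by $\sigma_1:(z_1,x,t_1)$, $\sigma_2:(t_1,t_2,z_2)$, $\sigma_3:(y,z_3,t_2)$, $\sigma_4:(z_1,y,s_1)$, $\sigma_5:(s_1,s_2,z_2)$, $\sigma_6:(x,z_3,s_2)$; all higher simplices are degenerate. Its realization is a torus. The class $[\gamma]\in\mathbb{Z}_2$ is $\sum_{i=1}^6\gamma(\sigma_i)$ mod $2$. A $2$-cocycle $\gamma$ is normalized if it vanishes on degenerate $2$-simplices. The twisted product $X_\gamma$ is the simplicial set with $n$-simplices $\mathbb{Z}_2^n\times X_n$, $d_i(\alpha,\tau)=(d_i\alpha,d_i\tau)$ for $1\le i\le n$, $s_j(\alpha,\tau)=(s_j\alpha,s_j\tau)$,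 $d_0(\alpha,\tau)=(\eta(\tau)+d_0\alpha,d_0\tau)$, with the nerve structure of $N\mathbb{Z}_2$ on $\alpha$ and $\eta(\tau)_1=\gamma(\tau|_{012})$, $\eta(\tau)_i=\gamma(\tau|_{0,i,i+1})-\gamma(\tau|_{1,i,i+1})$ for $2\le i\le n-1$ ($\tau|_{ijk}$ the face of $\tau\in X_n$ on vertices $i,j,k$); so $d_0((a,b),\sigma)=(\gamma(\sigma)+b,d_0\sigma)$ for $\sigma\in X_2$. For a simplicial set $Y$, $\pi_1(\mathbb{Z}_2,Y)$ is the group generated by $e_u$, $u\in Y_1$, with relations $e_u^2=1$ for $u\in Y_1$, and $[e_{d_i\sigma},e_{d_j\sigma}]=1$, $e_{d_2\sigma}e_{d_0\sigma}=e_{d_1\sigma}$ for $\sigma\in Y_2$, $i,j\in\{0,1,2\}$. *)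

theory Defs
  imports "HOL-Algebra.Product_Groups" "HOL-Algebra.Elementary_Groups" "HOL-Library.Z2"
begin

section \<open>Simplicial sets\<close>

text \<open>
  \<open>face X n i\<close> is $d_i : X_n \to X_{n-1}$ (meaningful for $1 \le n$ and $i \le n$) and
  \<open>degen X n j\<close> is $s_j : X_n \to X_{n+1}$ (meaningful for $j \le n$).
\<close>

record 'a sset =
  simplices :: "nat \<Rightarrow> 'a set"
  face :: "nat \<Rightarrow> nat \<Rightarrow> 'a \<Rightarrow> 'a"
  degen :: "nat \<Rightarrow> nat \<Rightarrow> 'a \<Rightarrow> 'a"

locale simplicial_set =
  fixes X :: "'a sset"
  assumes face_closed:
      "\<lbrakk>\<tau> \<in> simplices X (Suc n); i \<le> Suc n\<rbrakk> \<Longrightarrow> face X (Suc n) i \<tau> \<in> simplices X n"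
    and degen_closed:
      "\<lbrakk>\<tau> \<in> simplices X n; j \<le> n\<rbrakk> \<Longrightarrow> degen X n j \<tau> \<in> simplices X (Suc n)"
    and face_face:
      "\<lbrakk>\<tau> \<in> simplices X (Suc (Suc n)); i < j; j \<le> Suc (Suc n)\<rbrakk> \<Longrightarrow>
        face X (Suc n) i (face X (Suc (Suc n)) j \<tau>)
          = face X (Suc n) (j - 1) (face X (Suc (Suc n)) i \<tau>)"
    and degen_degen:
      "\<lbrakk>\<tau> \<in> simplices X n; i \<le> j; j \<le> n\<rbrakk> \<Longrightarrow>
        degen X (Suc n) i (degen X n j \<tau>) = degen X (Suc n) (Suc j) (degen X n i \<tau>)"
    and face_degen_less:
      "\<lbrakk>\<tau> \<in> simplices X (Suc n); i < j; j \<le> Suc n\<rbrakk> \<Longrightarrow>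
        face X (Suc (Suc n)) i (degen X (Suc n) j \<tau>) = degen X n (j - 1) (face X (Suc n) i \<tau>)"
    and face_degen_eq:
      "\<lbrakk>\<tau> \<in> simplices X n; j \<le> n; i = j \<or> i = Suc j\<rbrakk> \<Longrightarrow>
        face X (Suc n) i (degen X n j \<tau>) = \<tau>"
    and face_degen_greater:
      "\<lbrakk>\<tau> \<in> simplices X (Suc n); Suc j < i; i \<le> Suc (Suc n)\<rbrakk> \<Longrightarrow>
        face X (Suc (Suc n)) i (degen X (Suc n) j \<tau>) = degen X n j (face X (Suc n) (i - 1) \<tau>)"

text \<open>
  \<open>drop_vertices X m p K \<tau>\<close> removes from the \<open>m\<close>-simplex \<open>\<tau>\<close> all vertices \<open>q < p\<close> with
  \<open>q \<notin> K\<close>, highest first, so that the positions of the vertices still to be treated do not shift.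
  Hence \<open>subsimplex X n K \<tau>\<close> is the face $\tau|_K$ of $\tau \in X_n$ on the vertices in \<open>K\<close>.
\<close>

primrec drop_vertices :: "'a sset \<Rightarrow> nat \<Rightarrow> nat \<Rightarrow> nat set \<Rightarrow> 'a \<Rightarrow> 'a" where
  "drop_vertices X m 0 K \<tau> = \<tau>"
| "drop_vertices X m (Suc p) K \<tau> =
     (if p \<in> K then drop_vertices X m p K \<tau>
      else drop_vertices X (m - 1) p K (face X m p \<tau>))"

definition subsimplex :: "'a sset \<Rightarrow> nat \<Rightarrow> nat set \<Rightarrow> 'a \<Rightarrow> 'a" where
  "subsimplex X n K \<tau> = drop_vertices X n (Suc n) K \<tau>"


section \<open>Normalized cocycles and twisted products\<close>

definition cocycle2 :: "'a sset \<Rightarrow> ('a \<Rightarrow> bit) \<Rightarrow> bool" where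
  "cocycle2 X \<gamma> \<longleftrightarrow>
     (\<forall>\<rho>\<in>simplices X 3.
        \<gamma> (face X 3 0 \<rho>) - \<gamma> (face X 3 1 \<rho>) + \<gamma> (face X 3 2 \<rho>) - \<gamma> (face X 3 3 \<rho>) = 0)"

definition coboundary2 :: "'a sset \<Rightarrow> ('a \<Rightarrow> bit) \<Rightarrow> bool" where
  "coboundary2 X \<gamma> \<longleftrightarrow>
     (\<exists>f. \<forall>\<tau>\<in>simplices X 2. \<gamma> \<tau> = f (face X 2 0 \<tau>) - f (face X 2 1 \<tau>) + f (face X 2 2 \<tau>))"

definition normalized_cocycle2 :: "'a sset \<Rightarrow> ('a \<Rightarrow> bit) \<Rightarrow> bool" where
  "normalized_cocycle2 X \<gamma> \<longleftrightarrow>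
     cocycle2 X \<gamma> \<and> (\<forall>u\<in>simplices X 1. \<forall>j\<le>1. \<gamma> (degen X 1 j u) = 0)"

text \<open>An element $(a_1,\dots,a_n)$ of $(N\mathbb{Z}_2)_n = \mathbb{Z}_2^n$ is a list of length \<open>n\<close>,
  so $a_i$ is the entry with index \<open>i - 1\<close>.\<close>

definition nerve_Z2 :: "bit list sset" where
  "nerve_Z2 =
     \<lparr>simplices = (\<lambda>n. {a. length a = n}),
      face = (\<lambda>n i a.
        if i = 0 then tl a
        else if i = n then butlast a
        else take (i - 1) a @ [a ! (i - 1) + a ! i] @ drop (Suc i) a),
      degen = (\<lambda>n j a. take j a @ [0] @ drop j a)\<rparr>"

definition twist :: "'a sset \<Rightarrow> ('a \<Rightarrow> bit) \<Rightarrow> nat \<Rightarrow> 'a \<Rightarrow> bit list" where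
  "twist X \<gamma> n \<tau> =
     map (\<lambda>i. if i = 1 then \<gamma> (subsimplex X n {0, 1, 2} \<tau>)
              else \<gamma> (subsimplex X n {0, i, i + 1} \<tau>) - \<gamma> (subsimplex X n {1, i, i + 1} \<tau>))
       [1..<n]"

definition twisted_product :: "'a sset \<Rightarrow> ('a \<Rightarrow> bit) \<Rightarrow> (bit list \<times> 'a) sset" where
  "twisted_product X \<gamma> =
     \<lparr>simplices = (\<lambda>n. simplices nerve_Z2 n \<times> simplices X n),
      face = (\<lambda>n i (\<alpha>, \<tau>).
        (if i = 0 then map2 (+) (twist X \<gamma> n \<tau>) (face nerve_Z2 n 0 \<alpha>)
         else face nerve_Z2 n i \<alpha>,
         face X n i \<tau>)),
      degen = (\<lambda>n j (\<alpha>, \<tau>). (degen nerve_Z2 n j \<alpha>, degen X n j \<tau>))\<rparr>"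


section \<open>Groups given by generators and relations\<close>

text \<open>A word over \<open>S\<close> is a list of letters \<open>(s, b)\<close> with \<open>s \<in> S\<close>, where \<open>(s, True)\<close> stands
  for \<open>s\<close> and \<open>(s, False)\<close> for its formal inverse. A pair \<open>(l, r)\<close> of words in the set \<open>R\<close>
  is the relation \<open>l = r\<close>.\<close>

type_synonym 'g word = "('g \<times> bool) list"

definition words :: "'g set \<Rightarrow> 'g word set" where
  "words S = lists (S \<times> UNIV)"

inductive word_eq :: "'g set \<Rightarrow> ('g word \<times> 'g word) set \<Rightarrow> 'g word \<Rightarrow> 'g word \<Rightarrow> bool"
  for S :: "'g set" and R :: "('g word \<times> 'g word) set" where
  refl: "w \<in> words S \<Longrightarrow> word_eq S R w w"
| sym: "word_eq S R v w \<Longrightarrow> word_eq S R w v"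
| trans: "\<lbrakk>word_eq S R u v; word_eq S R v w\<rbrakk> \<Longrightarrow> word_eq S R u w"
| cancel: "\<lbrakk>u \<in> words S; v \<in> words S; s \<in> S\<rbrakk> \<Longrightarrow>
    word_eq S R (u @ [(s, b), (s, \<not> b)] @ v) (u @ v)"
| relation: "\<lbrakk>u \<in> words S; v \<in> words S; (l, r) \<in> R; l \<in> words S; r \<in> words S\<rbrakk> \<Longrightarrow>
    word_eq S R (u @ l @ v) (u @ r @ v)"

definition presented_group :: "'g set \<Rightarrow> ('g word \<times> 'g word) set \<Rightarrow> 'g word set monoid" where
  "presented_group S R =
     \<lparr>carrier = words S // {(v, w). word_eq S R v w},
      mult = (\<lambda>P Q. {w. \<exists>u\<in>P. \<exists>v\<in>Q. word_eq S R (u @ v) w}),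
      one = {w. word_eq S R [] w}\<rparr>"

text \<open>The group $\pi_1(\mathbb{Z}_2, Y)$.\<close>

definition pi1_relations :: "'a sset \<Rightarrow> ('a word \<times> 'a word) set" where
  "pi1_relations Y =
     {([(u, True), (u, True)], []) | u. u \<in> simplices Y 1}
   \<union> {([(face Y 2 i \<sigma>, True), (face Y 2 j \<sigma>, True), (face Y 2 i \<sigma>, False), (face Y 2 j \<sigma>, False)], [])
        | \<sigma> i j. \<sigma> \<in> simplices Y 2 \<and> i \<in> {0, 1, 2} \<and> j \<in> {0, 1, 2}}
   \<union> {([(face Y 2 2 \<sigma>, True), (face Y 2 0 \<sigma>, True)], [(face Y 2 1 \<sigma>, True)])
        | \<sigma>. \<sigma> \<in> simplices Y 2}"

definition pi1_Z2 :: "'a sset \<Rightarrow> 'a word set monoid" where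
  "pi1_Z2 Y = presented_group (simplices Y 1) (pi1_relations Y)"


section \<open>The torus\<close>

text \<open>The nondegenerate simplices; \<open>cell_faces c\<close> lists $d_0, d_1, \dots$ of the cell \<open>c\<close> in this
  order. So an edge is given as \<open>[target, source]\<close> and a triangle as $[d_0, d_1, d_2]$.\<close>

datatype torus_cell =
    vA | vB | vC
  | ez1 | et1 | es1 | ex | ey | et2 | es2 | ez3 | ez2
  | sigma1 | sigma2 | sigma3 | sigma4 | sigma5 | sigma6

fun cell_faces :: "torus_cell \<Rightarrow> torus_cell list" where
  "cell_faces vA = []"
| "cell_faces vB = []"
| "cell_faces vC = []"
| "cell_faces ez1 = [vB, vA]"
| "cell_faces et1 = [vB, vA]"
| "cell_faces es1 = [vB, vA]"
| "cell_faces ex = [vB, vB]"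
| "cell_faces ey = [vB, vB]"
| "cell_faces et2 = [vC, vB]"
| "cell_faces es2 = [vC, vB]"
| "cell_faces ez3 = [vC, vB]"
| "cell_faces ez2 = [vC, vA]"
| "cell_faces sigma1 = [ex, et1, ez1]"
| "cell_faces sigma2 = [et2, ez2, et1]"
| "cell_faces sigma3 = [ez3, et2, ey]"
| "cell_faces sigma4 = [ey, es1, ez1]"
| "cell_faces sigma5 = [es2, ez2, es1]"
| "cell_faces sigma6 = [ez3, es2, ex]"

definition cell_dim :: "torus_cell \<Rightarrow> nat" where
  "cell_dim c = length (cell_faces c) - 1"

text \<open>
  By the Eilenberg-Zilber lemma an \<open>n\<close>-simplex is uniquely $\theta^* c$ with \<open>c\<close> a nondegenerate
  \<open>k\<close>-simplex and $\theta : [n] \to [k]$ a monotone surjection; it is encoded as \<open>(c, w)\<close> with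
  \<open>w\<close> the list of values of $\theta$. It is nondegenerate iff \<open>w = [0..<Suc k]\<close>. If deleting
  the \<open>i\<close>-th entry \<open>j\<close> of \<open>w\<close> destroys surjectivity, then $d_i$ passes to the face $d_j c$,
  which is again nondegenerate for all cells of the torus.
\<close>

definition torus :: "(torus_cell \<times> nat list) sset" where
  "torus =
     \<lparr>simplices = (\<lambda>n. {(c, w). length w = Suc n \<and> sorted w \<and> set w = {0..cell_dim c}}),
      face = (\<lambda>n i (c, w).
        let w' = take i w @ drop (Suc i) w; j = w ! i
        in if j \<in> set w' then (c, w')
           else (cell_faces c ! j, map (\<lambda>k. if j < k then k - 1 else k) w')),
      degen = (\<lambda>n j (c, w). (c, take (Suc j) w @ drop j w))\<rparr>"

definition nondeg :: "torus_cell \<Rightarrow> torus_cell \<times> nat list" where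
  "nondeg c = (c, [0..<Suc (cell_dim c)])"

text \<open>
  The encoding does define a simplicial set: \<open>torus_pull c v\<close> is $\theta^* c$ for an arbitrary
  monotone map $\theta$ with list of values \<open>v\<close>, and all structure maps act by deleting or
  repeating entries of \<open>v\<close>.
\<close>

definition subcell :: "torus_cell \<Rightarrow> nat set \<Rightarrow> torus_cell" where
  "subcell c A =
     (if A = {0..cell_dim c} then c
      else if cell_dim c = 1 then (if A = {0} then cell_faces c ! 1 else cell_faces c ! 0)
      else if A = {0, 1} then cell_faces c ! 2
      else if A = {0, 2} then cell_faces c ! 1
      else if A = {1, 2} then cell_faces c ! 0
      else if A = {0} then cell_faces (cell_faces c ! 2) ! 1
      else if A = {1} then cell_faces (cell_faces c ! 2) ! 0
      else cell_faces (cell_faces c ! 0) ! 0)"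

definition index_in :: "nat set \<Rightarrow> nat \<Rightarrow> nat" where
  "index_in A k = length (filter (\<lambda>a. a \<in> A) [0..<k])"

definition delete_nth :: "nat \<Rightarrow> 'a list \<Rightarrow> 'a list" where "delete_nth i w = take i w @ drop (Suc i) w"
definition repeat_nth :: "nat \<Rightarrow> 'a list \<Rightarrow> 'a list" where "repeat_nth j w = take (Suc j) w @ drop j w"

definition torus_pull :: "torus_cell \<Rightarrow> nat list \<Rightarrow> torus_cell \<times> nat list" where
  "torus_pull c v = (subcell c (set v), map (index_in (set v)) v)"

lemma index_in_card: "index_in A k = card {a \<in> A. a < k}"
proof -
  have "{a \<in> A. a < k} = set (filter (\<lambda>a. a \<in> A) [0..<k])" by auto
  then show ?thesis
    unfolding index_in_def using distinct_card[of "filter (\<lambda>a. a \<in> A) [0..<k]"] by simp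
qed

lemma cell_dim_cases: "cell_dim c = 0 \<or> cell_dim c = 1 \<or> cell_dim c = 2"
  by (cases c) (auto simp: cell_dim_def)

lemma index_in_full: "k \<le> d \<Longrightarrow> index_in {0..d} k = k"
proof -
  assume "k \<le> d"
  then have "{a \<in> {0..d}. a < k} = {..<k}" by auto
  then show ?thesis by (simp add: index_in_card)
qed

lemma torus_pull_full: "set w = {0..cell_dim c} \<Longrightarrow> torus_pull c w = (c, w)"
  by (auto simp: torus_pull_def subcell_def index_in_full intro: map_idI)

lemma nonempty_subset_le_2: assumes "A \<subseteq> {0..d}" "d = 0 \<or> d = 1 \<or> d = (2::nat)" "A \<noteq> {}"
  shows "A = {0} \<or> A = {1} \<or> A = {2} \<or> A = {0,1} \<or> A = {0,2} \<or> A = {1,2} \<or> A = {0,1,2}"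
proof -
  have "k = 0 \<or> k = 1 \<or> k = 2" if "k \<in> A" for k
  proof -
    have "k \<le> d" using assms(1) that by auto
    then show ?thesis using assms(2) by linarith
  qed
  then have "A = (if 0 \<in> A then {0} else {}) \<union> (if 1 \<in> A then {1} else {}) \<union> (if 2 \<in> A then {2} else {})"
    by (auto split: if_splits)
  then obtain p q r where e: "A = (if p then {0} else {}) \<union> (if q then {1} else {}) \<union> (if r then {2} else {})"
    by blast
  have "p \<or> q \<or> r" using e assms(3) by (cases p; cases q; cases r) simp_all
  then show ?thesis unfolding e by (cases p; cases q; cases r) (simp_all add: insert_commute)
qed

lemma subcell_face:
  assumes "A \<subseteq> {0..cell_dim c}" "a \<in> A" "A - {a} \<noteq> {}"
  shows "cell_faces (subcell c A) ! index_in A a = subcell c (A - {a})"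
proof -
  have A: "A = {0} \<or> A = {1} \<or> A = {2} \<or> A = {0,1} \<or> A = {0,2} \<or> A = {1,2} \<or> A = {0,1,2}"
    by (rule nonempty_subset_le_2[OF assms(1) cell_dim_cases]) (use assms(2) in auto)
  have all: "\<forall>c\<in>set [vA,vB,vC,ez1,et1,es1,ex,ey,et2,es2,ez3,ez2,sigma1,sigma2,sigma3,sigma4,sigma5,sigma6].
     \<forall>A\<in>set (map set [[0],[1],[2],[0,1],[0,2],[1,2],[0,1,2]]). A \<subseteq> {0..cell_dim c} \<longrightarrow>
       (\<forall>a\<in>A. A - {a} \<noteq> {} \<longrightarrow> cell_faces (subcell c A) ! index_in A a = subcell c (A - {a}))"
    by code_simp
  have cc: "c \<in> set [vA,vB,vC,ez1,et1,es1,ex,ey,et2,es2,ez3,ez2,sigma1,sigma2,sigma3,sigma4,sigma5,sigma6]"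
    by (cases c) auto
  moreover have AA: "A\<in>set (map set [[0],[1],[2],[0,1],[0,2],[1,2],[0,1,2]])" using A by auto
  ultimately show ?thesis using all[rule_format, OF cc AA assms(1) assms(2) assms(3)] by simp
qed

lemma subcell_dim:
  assumes "A \<subseteq> {0..cell_dim c}" "A \<noteq> {}"
  shows "index_in A ` A = {0..cell_dim (subcell c A)}"
proof -
  have A: "A = {0} \<or> A = {1} \<or> A = {2} \<or> A = {0,1} \<or> A = {0,2} \<or> A = {1,2} \<or> A = {0,1,2}"
    by (rule nonempty_subset_le_2[OF assms(1) cell_dim_cases]) (use assms(2) in auto)
  have all: "\<forall>c\<in>set [vA,vB,vC,ez1,et1,es1,ex,ey,et2,es2,ez3,ez2,sigma1,sigma2,sigma3,sigma4,sigma5,sigma6].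
     \<forall>A\<in>set (map set [[0],[1],[2],[0,1],[0,2],[1,2],[0,1,2]]). A \<subseteq> {0..cell_dim c} \<longrightarrow>
       index_in A ` A = {0..cell_dim (subcell c A)}"
    by code_simp
  have cc: "c \<in> set [vA,vB,vC,ez1,et1,es1,ex,ey,et2,es2,ez3,ez2,sigma1,sigma2,sigma3,sigma4,sigma5,sigma6]"
    by (cases c) auto
  moreover have AA: "A\<in>set (map set [[0],[1],[2],[0,1],[0,2],[1,2],[0,1,2]])" using A by auto
  ultimately show ?thesis using all[rule_format, OF cc AA assms(1)] by simp
qed

lemma index_in_mono: "finite A \<Longrightarrow> k \<le> l \<Longrightarrow> index_in A k \<le> index_in A l"
  unfolding index_in_card by (rule card_mono) auto

lemma index_in_less: "finite A \<Longrightarrow> k \<in> A \<Longrightarrow> k < l \<Longrightarrow> index_in A k < index_in A l"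
  unfolding index_in_card by (rule psubset_card_mono) auto

lemma index_in_less_iff: "finite A \<Longrightarrow> k \<in> A \<Longrightarrow> index_in A k < index_in A l \<longleftrightarrow> k < l"
  by (meson index_in_less index_in_mono not_le)

lemma index_in_eq_iff: "finite A \<Longrightarrow> k \<in> A \<Longrightarrow> l \<in> A \<Longrightarrow> index_in A k = index_in A l \<longleftrightarrow> k = l"
  by (metis nat_neq_iff index_in_less)

lemma index_in_remove: "finite A \<Longrightarrow> a \<in> A \<Longrightarrow> k \<in> A \<Longrightarrow>
   index_in (A - {a}) k = (if index_in A a < index_in A k then index_in A k - 1 else index_in A k)"
proof -
  assume *: "finite A" "a \<in> A" "k \<in> A"
  have "{x \<in> A - {a}. x < k} = {x \<in> A. x < k} - {a}" by auto
  then show ?thesis using * by (simp add: index_in_card[of "A - {a}"] index_in_less_iff card_Diff_singleton_if)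
     (simp add: index_in_card)
qed

lemma set_delete_nth: "i < length w \<Longrightarrow> set w = insert (w ! i) (set (delete_nth i w))"
  unfolding delete_nth_def by (subst id_take_nth_drop[of i w]) auto

lemma face_torus: "face torus n i (c,w) = (if w!i \<in> set (delete_nth i w) then (c, delete_nth i w)
   else (cell_faces c ! (w!i), map (\<lambda>k. if w!i < k then k-1 else k) (delete_nth i w)))"
  by (simp add: torus_def delete_nth_def Let_def)

lemma delete_nth_map: "delete_nth i (map f v) = map f (delete_nth i v)"
  by (simp add: delete_nth_def take_map drop_map)

lemma face_torus_pull:
  assumes v: "set v \<subseteq> {0..cell_dim c}" "length v \<ge> 2" "i < length v"
  shows "face torus n i (torus_pull c v) = torus_pull c (delete_nth i v)"
proof -
  have "length (delete_nth i v) \<ge> 1" using v by (simp add: delete_nth_def)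
  then have ne: "set (delete_nth i v) \<noteq> {}" by auto
  have s: "set v = insert (v ! i) (set (delete_nth i v))" using v(3) by (rule set_delete_nth)
  have mem: "index_in (set v) (v ! i) \<in> index_in (set v) ` set (delete_nth i v) \<longleftrightarrow> v ! i \<in> set (delete_nth i v)"
  proof
    assume "index_in (set v) (v ! i) \<in> index_in (set v) ` set (delete_nth i v)"
    then obtain k where k: "k \<in> set (delete_nth i v)" "index_in (set v) (v ! i) = index_in (set v) k" by blast
    then have "k \<in> set v" using s by blast
    then have "v ! i = k" using index_in_eq_iff[of "set v" "v!i" k] v(3) k by simp
    then show "v ! i \<in> set (delete_nth i v)" using k by simp
  qed simp
  have fp: "face torus n i (torus_pull c v) = (if v ! i \<in> set (delete_nth i v) then (subcell c (set v), map (index_in (set v)) (delete_nth i v))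
     else (cell_faces (subcell c (set v)) ! index_in (set v) (v ! i),
           map (\<lambda>k. if index_in (set v) (v ! i) < k then k-1 else k) (map (index_in (set v)) (delete_nth i v))))"
    unfolding torus_pull_def face_torus delete_nth_map set_map nth_map[OF v(3)] mem ..
  show ?thesis
  proof (cases "v ! i \<in> set (delete_nth i v)")
    case True
    then have "set (delete_nth i v) = set v" using s by (simp add: insert_absorb)
    then show ?thesis unfolding fp using True by (simp add: torus_pull_def)
  next
    case False
    then have e: "set (delete_nth i v) = set v - {v ! i}" using s by simp
    have "cell_faces (subcell c (set v)) ! index_in (set v) (v ! i) = subcell c (set v - {v ! i})"
      by (rule subcell_face) (use v ne e in simp_all)
    moreover have "map (\<lambda>k. if index_in (set v) (v ! i) < k then k-1 else k) (map (index_in (set v)) (delete_nth i v))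
      = map (index_in (set v - {v ! i})) (delete_nth i v)"
    proof -
      have "(if index_in (set v) (v ! i) < index_in (set v) k then index_in (set v) k - 1 else index_in (set v) k)
         = index_in (set v - {v ! i}) k" if "k \<in> set (delete_nth i v)" for k
        using index_in_remove[of "set v" "v!i" k] v(3) that e by simp
      then show ?thesis by simp
    qed
    ultimately show ?thesis unfolding fp using False by (simp add: torus_pull_def e)
  qed
qed

lemma set_repeat_nth: "set (repeat_nth j v) = set v"
proof -
  have "set (take j v) \<subseteq> set (take (Suc j) v)" by (rule set_take_subset_set_take) simp
  moreover have "set v = set (take j v) \<union> set (drop j v)" by (metis append_take_drop_id set_append)
  moreover have "set (take (Suc j) v) \<subseteq> set v" by (rule set_take_subset)
  ultimately show ?thesis by (auto simp: repeat_nth_def)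
qed

lemma degen_torus_pull: "degen torus n j (torus_pull c v) = torus_pull c (repeat_nth j v)"
  using set_repeat_nth[of j v] by (simp add: torus_def torus_pull_def) (simp add: repeat_nth_def take_map drop_map)

lemma length_delete_nth: "i < length w \<Longrightarrow> length (delete_nth i w) = length w - 1" by (simp add: delete_nth_def)
lemma length_repeat_nth: "j < length w \<Longrightarrow> length (repeat_nth j w) = Suc (length w)" by (simp add: repeat_nth_def)
lemma nth_delete_nth: "i < length w \<Longrightarrow> k < length w - 1 \<Longrightarrow> delete_nth i w ! k = w ! (if k < i then k else Suc k)"
  by (auto simp: delete_nth_def nth_append)
lemma nth_repeat_nth: "j < length w \<Longrightarrow> k \<le> length w \<Longrightarrow> repeat_nth j w ! k = w ! (if k \<le> j then k else k - 1)"
  by (auto simp: repeat_nth_def nth_append less_Suc_eq_le)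
lemma sorted_delete_nth: "i < length w \<Longrightarrow> sorted w \<Longrightarrow> sorted (delete_nth i w)"
  by (auto simp: sorted_iff_nth_mono length_delete_nth nth_delete_nth)

lemma sorted_repeat_nth: "sorted w \<Longrightarrow> j < length w \<Longrightarrow> sorted (repeat_nth j w)"
  by (auto simp: sorted_iff_nth_mono length_repeat_nth nth_repeat_nth)

lemma simplices_torus_iff: "\<tau> \<in> simplices torus n \<longleftrightarrow>
   (\<exists>c v. \<tau> = torus_pull c v \<and> length v = Suc n \<and> sorted v \<and> set v \<subseteq> {0..cell_dim c})"
proof
  assume "\<tau> \<in> simplices torus n"
  then obtain c w where "\<tau> = (c,w)" "length w = Suc n" "sorted w" "set w = {0..cell_dim c}"
    by (auto simp: torus_def)
  then show "\<exists>c v. \<tau> = torus_pull c v \<and> length v = Suc n \<and> sorted v \<and> set v \<subseteq> {0..cell_dim c}"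
    using torus_pull_full by (metis order_refl)
next
  assume "\<exists>c v. \<tau> = torus_pull c v \<and> length v = Suc n \<and> sorted v \<and> set v \<subseteq> {0..cell_dim c}"
  then obtain c v where *: "\<tau> = torus_pull c v" "length v = Suc n" "sorted v" "set v \<subseteq> {0..cell_dim c}" by auto
  then have "index_in (set v) ` set v = {0..cell_dim (subcell c (set v))}" by (intro subcell_dim) auto
  with * show "\<tau> \<in> simplices torus n"
    by (simp add: torus_def torus_pull_def sorted_map) (metis (no_types, lifting) List.finite_set index_in_mono sorted_wrt_mono_rel)
qed

lemma set_delete_nth_subset: "i < length v \<Longrightarrow> set v \<subseteq> S \<Longrightarrow> set (delete_nth i v) \<subseteq> S" using set_delete_nth by fastforce

lemma simplicial_set_torus: "simplicial_set torus"
proof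
  fix \<tau> n i assume *: "\<tau> \<in> simplices torus (Suc n)" "i \<le> Suc n"
  then obtain c v where v: "\<tau> = torus_pull c v" "length v = Suc (Suc n)" "sorted v" "set v \<subseteq> {0..cell_dim c}"
    unfolding simplices_torus_iff by blast
  show "face torus (Suc n) i \<tau> \<in> simplices torus n"
    unfolding simplices_torus_iff using v * by (intro exI[of _ c] exI[of _ "delete_nth i v"]) (simp add: face_torus_pull length_delete_nth sorted_delete_nth set_delete_nth_subset)
next
  fix \<tau> n j assume *: "\<tau> \<in> simplices torus n" "j \<le> n"
  then obtain c v where v: "\<tau> = torus_pull c v" "length v = Suc n" "sorted v" "set v \<subseteq> {0..cell_dim c}"
    unfolding simplices_torus_iff by blast
  show "degen torus n j \<tau> \<in> simplices torus (Suc n)"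
    unfolding simplices_torus_iff using v * by (intro exI[of _ c] exI[of _ "repeat_nth j v"]) (simp add: degen_torus_pull length_repeat_nth sorted_repeat_nth set_repeat_nth)
next
  fix \<tau> n i and j :: nat assume *: "\<tau> \<in> simplices torus (Suc (Suc n))" "i < j" "j \<le> Suc (Suc n)"
  then obtain c v where v: "\<tau> = torus_pull c v" "length v = Suc (Suc (Suc n))" "set v \<subseteq> {0..cell_dim c}"
    unfolding simplices_torus_iff by blast
  have "delete_nth i (delete_nth j v) = delete_nth (j-1) (delete_nth i v)"
    using v * by (intro nth_equalityI) (auto simp: nth_delete_nth length_delete_nth)
  then show "face torus (Suc n) i (face torus (Suc (Suc n)) j \<tau>)
          = face torus (Suc n) (j - 1) (face torus (Suc (Suc n)) i \<tau>)"
    using v * by (simp add: face_torus_pull length_delete_nth set_delete_nth_subset)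
next
  fix \<tau> n i and j :: nat assume *: "\<tau> \<in> simplices torus n" "i \<le> j" "j \<le> n"
  then obtain c v where v: "\<tau> = torus_pull c v" "length v = Suc n" "set v \<subseteq> {0..cell_dim c}"
    unfolding simplices_torus_iff by blast
  have "repeat_nth i (repeat_nth j v) = repeat_nth (Suc j) (repeat_nth i v)"
    using v * by (intro nth_equalityI) (auto simp: nth_repeat_nth length_repeat_nth)
  then show "degen torus (Suc n) i (degen torus n j \<tau>) = degen torus (Suc n) (Suc j) (degen torus n i \<tau>)"
    using v by (simp add: degen_torus_pull)
next
  fix \<tau> n i and j :: nat assume *: "\<tau> \<in> simplices torus (Suc n)" "i < j" "j \<le> Suc n"
  then obtain c v where v: "\<tau> = torus_pull c v" "length v = Suc (Suc n)" "set v \<subseteq> {0..cell_dim c}"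
    unfolding simplices_torus_iff by blast
  have "delete_nth i (repeat_nth j v) = repeat_nth (j-1) (delete_nth i v)"
    using v * by (intro nth_equalityI) (auto simp: nth_repeat_nth length_repeat_nth nth_delete_nth length_delete_nth)
  then show "face torus (Suc (Suc n)) i (degen torus (Suc n) j \<tau>) = degen torus n (j - 1) (face torus (Suc n) i \<tau>)"
    using v * by (simp add: degen_torus_pull face_torus_pull set_repeat_nth length_repeat_nth)
next
  fix \<tau> n i and j :: nat assume *: "\<tau> \<in> simplices torus n" "j \<le> n" "i = j \<or> i = Suc j"
  then obtain c v where v: "\<tau> = torus_pull c v" "length v = Suc n" "set v \<subseteq> {0..cell_dim c}"
    unfolding simplices_torus_iff by blast
  have "delete_nth i (repeat_nth j v) = v"
    using v * by (intro nth_equalityI) (auto simp: nth_repeat_nth length_repeat_nth nth_delete_nth length_delete_nth)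
  then show "face torus (Suc n) i (degen torus n j \<tau>) = \<tau>"
    using v * by (auto simp add: degen_torus_pull face_torus_pull set_repeat_nth length_repeat_nth)
next
  fix \<tau> n i and j :: nat assume *: "\<tau> \<in> simplices torus (Suc n)" "Suc j < i" "i \<le> Suc (Suc n)"
  then obtain c v where v: "\<tau> = torus_pull c v" "length v = Suc (Suc n)" "set v \<subseteq> {0..cell_dim c}"
    unfolding simplices_torus_iff by blast
  have "delete_nth i (repeat_nth j v) = repeat_nth j (delete_nth (i-1) v)"
    using v * by (intro nth_equalityI) (auto simp: nth_repeat_nth length_repeat_nth nth_delete_nth length_delete_nth)
  then show "face torus (Suc (Suc n)) i (degen torus (Suc n) j \<tau>) = degen torus n j (face torus (Suc n) (i - 1) \<tau>)"
    using v * by (simp add: degen_torus_pull face_torus_pull set_repeat_nth length_repeat_nth)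
qed

text \<open>The class $[\gamma] \in H^2(X, \mathbb{Z}_2) \cong \mathbb{Z}_2$; \<open>torus_class_eq_0_iff\<close> below
  shows that it vanishes exactly on the coboundaries.\<close>

definition torus_class :: "(torus_cell \<times> nat list \<Rightarrow> bit) \<Rightarrow> bit" where
  "torus_class \<gamma> = (\<Sum>c\<in>{sigma1, sigma2, sigma3, sigma4, sigma5, sigma6}. \<gamma> (nondeg c))"

lemma face_torus_Let: "face torus n i (c, w) =
    (let w' = take i w @ drop (Suc i) w; j = w ! i
     in if j \<in> set w' then (c, w')
        else (cell_faces c ! j, map (\<lambda>k. if j < k then k - 1 else k) w'))"
  by (simp add: torus_def)

lemma torus_simplices2:
  assumes "\<tau> \<in> simplices torus 2"
  obtains c where "cell_dim c = 2" "\<tau> = nondeg c"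
  | c a b where "(c, [a, b]) \<in> simplices torus 1" "\<tau> = (c, [a, a, b])"
  | c a b where "(c, [a, b]) \<in> simplices torus 1" "\<tau> = (c, [a, b, b])"
proof -
  obtain c w where t: "\<tau> = (c, w)" "length w = 3" "sorted w" "set w = {0..cell_dim c}"
    using assms by (auto simp: torus_def)
  then obtain p q r where w: "w = [p, q, r]"
    by (auto simp: length_Suc_conv eval_nat_numeral)
  show ?thesis
  proof (cases "p = q \<or> q = r")
    case True
    then show ?thesis
    proof
      assume "p = q" then show ?thesis using that(2)[of c q r] t w by (auto simp: torus_def)
    next
      assume "q = r" then show ?thesis using that(3)[of c p q] t w by (auto simp: torus_def)
    qed
  next
    case False
    then have less: "p < q" "q < r" using t(3) w by auto
    then have "card (set w) = 3" using w by simp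
    then have d: "cell_dim c = 2" using t(4) by simp
    then have "r \<le> 2" using t(4) w by auto
    then have "p = 0" "q = 1" "r = 2" using less by auto
    then show ?thesis using that(1)[of c] d t(1) w by (simp add: nondeg_def eval_nat_numeral)
  qed
qed

lemma bit_add_self: "x + x = (0::bit)" "x + (x + y) = (y::bit)"
  by (cases x; cases y; simp)+

lemma torus_class_eq_0_iff:
  assumes "normalized_cocycle2 torus \<gamma>"
  shows "torus_class \<gamma> = 0 \<longleftrightarrow> coboundary2 torus \<gamma>"
proof
  assume "coboundary2 torus \<gamma>"
  then obtain f where f: "\<And>\<tau>. \<tau> \<in> simplices torus 2 \<Longrightarrow>
      \<gamma> \<tau> = f (face torus 2 0 \<tau>) - f (face torus 2 1 \<tau>) + f (face torus 2 2 \<tau>)"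
    by (auto simp: coboundary2_def)
  have mem: "nondeg c \<in> simplices torus 2" if "cell_dim c = 2" for c
    using that by (auto simp: nondeg_def torus_def eval_nat_numeral)
  have s: "\<gamma> (nondeg c) = f (cell_faces c ! 0, [0, 1]) + f (cell_faces c ! 1, [0, 1])
      + f (cell_faces c ! 2, [0, 1])" if "cell_dim c = 2" for c
    using f[OF mem[OF that]] that
    by (simp add: nondeg_def face_torus_Let eval_nat_numeral)
  show "torus_class \<gamma> = 0"
    unfolding torus_class_def
    by (simp add: s cell_dim_def)
       (cases "f (ex, [0, Suc 0])"; cases "f (ey, [0, Suc 0])"; cases "f (ez1, [0, Suc 0])";
        cases "f (et1, [0, Suc 0])"; cases "f (es1, [0, Suc 0])"; cases "f (et2, [0, Suc 0])";
        cases "f (es2, [0, Suc 0])"; cases "f (ez2, [0, Suc 0])"; cases "f (ez3, [0, Suc 0])"; simp)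
next
  assume 0: "torus_class \<gamma> = 0"
  let ?g = "\<lambda>c. \<gamma> (nondeg c)"
  define h where "h = (\<lambda>c. if c = et1 then ?g sigma2 else if c = ex then ?g sigma6
     else if c = ey then ?g sigma3 else if c = es1 then ?g sigma5
     else if c = ez1 then ?g sigma4 + ?g sigma3 + ?g sigma5 else 0)"
  define f where "f = (\<lambda>t. if snd t = [0, 1::nat] then h (fst t) else 0)"
  have sum: "?g sigma1 = ?g sigma2 + ?g sigma3 + ?g sigma4 + ?g sigma5 + ?g sigma6"
    using 0 unfolding torus_class_def
    by (cases "?g sigma1"; cases "?g sigma2"; cases "?g sigma3"; cases "?g sigma4"; cases "?g sigma5"; cases "?g sigma6") simp_all
  have deg: "\<gamma> (degen torus 1 j u) = 0" if "u \<in> simplices torus 1" "j \<le> 1" for u j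
    using assms that by (auto simp: normalized_cocycle2_def)
  have "\<gamma> \<tau> = f (face torus 2 0 \<tau>) - f (face torus 2 1 \<tau>) + f (face torus 2 2 \<tau>)"
    if "\<tau> \<in> simplices torus 2" for \<tau>
    using that
  proof (cases rule: torus_simplices2)
    case (1 c)
    then have "f (face torus 2 0 \<tau>) - f (face torus 2 1 \<tau>) + f (face torus 2 2 \<tau>)
       = h (cell_faces c ! 0) + h (cell_faces c ! 1) + h (cell_faces c ! 2)"
      by (simp add: nondeg_def face_torus_Let eval_nat_numeral f_def)
    moreover have "?g c = h (cell_faces c ! 0) + h (cell_faces c ! 1) + h (cell_faces c ! 2)"
      using 1(1)
      by (cases c) (simp_all add: cell_dim_def h_def sum, (cases "?g sigma2"; cases "?g sigma3";
        cases "?g sigma4"; cases "?g sigma5"; cases "?g sigma6"; simp)+)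
    ultimately show ?thesis using 1 by simp
  next
    case (2 c a b)
    have "\<gamma> \<tau> = 0"
      using deg[OF 2(1), of 0] 2(2) by (simp add: torus_def)
    moreover have "face torus 2 0 \<tau> = face torus 2 1 \<tau>"
      unfolding 2(2) face_torus_Let by simp
    moreover have "snd (face torus 2 2 \<tau>) \<noteq> [0, 1]"
      unfolding 2(2) face_torus_Let Let_def by simp presburger
    then have "f (face torus 2 2 \<tau>) = 0"
      unfolding f_def by (rule if_not_P)
    ultimately show ?thesis by simp
  next
    case (3 c a b)
    have "\<gamma> \<tau> = 0"
      using deg[OF 3(1), of 1] 3(2) by (simp add: torus_def)
    moreover have "face torus 2 1 \<tau> = face torus 2 2 \<tau>"
      unfolding 3(2) face_torus_Let by (simp add: numeral_2_eq_2)
    moreover have "snd (face torus 2 0 \<tau>) \<noteq> [0, 1]"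
      unfolding 3(2) face_torus_Let Let_def by simp presburger
    then have "f (face torus 2 0 \<tau>) = 0"
      unfolding f_def by (rule if_not_P)
    ultimately show ?thesis by simp
  qed
  then show "coboundary2 torus \<gamma>" unfolding coboundary2_def by blast
qed


section \<open>The groups in the classification\<close>

text \<open>\<open>dihedral_group n\<close>, of order \<open>2 * n\<close>, is the semidirect product $\mathbb{Z}_n \rtimes \mathbb{Z}_2$
  with $\mathbb{Z}_2$ acting by inversion; \<open>(a, e)\<close> is $r^a s^e$. So $D_8$ is \<open>dihedral_group 4\<close>.\<close>

definition dihedral_group :: "nat \<Rightarrow> (int \<times> bit) monoid" where
  "dihedral_group n =
     \<lparr>carrier = {0..<int n} \<times> UNIV,
      mult = (\<lambda>(a, e) (b, f). ((if e = 0 then a + b else a - b) mod int n, e + f)),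
      one = (0, 0)\<rparr>"

definition group_center :: "('a, 'b) monoid_scheme \<Rightarrow> 'a set" where
  "group_center G = {z \<in> carrier G. \<forall>g\<in>carrier G. z \<otimes>\<^bsub>G\<^esub> g = g \<otimes>\<^bsub>G\<^esub> z}"

text \<open>The central product of \<open>G\<close> and \<open>H\<close> with respect to an isomorphism \<open>\<theta>\<close> from the center of
  \<open>G\<close> onto the center of \<open>H\<close>.\<close>

definition central_product ::
  "('a, 'c) monoid_scheme \<Rightarrow> ('b, 'd) monoid_scheme \<Rightarrow> ('a \<Rightarrow> 'b) \<Rightarrow> ('a \<times> 'b) set monoid" where
  "central_product G H \<theta> =
     (G \<times>\<times> H) Mod ((\<lambda>z. (z, inv\<^bsub>H\<^esub> (\<theta> z))) ` group_center G)"

end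

theory Submission
  imports Defs
begin

text \<open>
  Degenerate triangles of $X_\gamma$ show that the generator of an edge $(a, u)$ is $J^a T_u$, with $T_u$ the generator of $(0, u)$ and \<open>J\<close> one
  central involution, the same for all edges because \<open>X\<close> is connected. What remains are nine
  involutions $T_u$, one for each nondegenerate edge, and for each triangle $\sigma$ the relation
  $T_{d_2\sigma} T_{d_0\sigma} = J^{\gamma(\sigma)} T_{d_1\sigma}$, which also makes the three
  involutions commute. Each edge lies on two triangles, so this is a Mermin square, with the rows
  $\sigma_1, \sigma_3, \sigma_5$ and the columns $\sigma_4, \sigma_6, \sigma_2$:
  $(z_1, x, t_1)$, $(y, z_3, t_2)$, $(s_1, s_2, z_2)$.

  The entries $A = z_1$, $B = z_3$, $C = x$, $D = y$ and \<open>J\<close> generate the group. The pairs $A, C$;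
  $A, D$; $B, C$; $B, D$ share a triangle and commute. Comparing the two ways of computing $z_2$, by row
  and by column, shows that $A, B$ as well as $C, D$ commute up to $J^c$, where \<open>c\<close> is the sum of all
  $\gamma(\sigma_i)$, that is $[\gamma]$ (\<open>mermin_square\<close>). Conversely these relations define a group
  of order $32$, here built explicitly as \<open>square_group c\<close>, in which the nine edges can be
  labelled so that all relations hold (\<open>edge_label_triangle\<close>). So the given group is
  \<open>square_group c\<close> (\<open>pi1_twisted_torus_iso\<close>). For \<open>c = 0\<close> this is $\mathbb{Z}_2^5$; for
  \<open>c = 1\<close> both $A, B$ and $C, D$ generate a dihedral group of order $8$ with center
  $\{1, J\}$, and the two commute with each other, which gives their central product.
\<close>


section \<open>Universal property of presented groups\<close>

definition word_class :: "'g set \<Rightarrow> ('g word \<times> 'g word) set \<Rightarrow> 'g word \<Rightarrow> 'g word set" where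
  "word_class S R w = {v. word_eq S R w v}"

text \<open>The value of a word in \<open>H\<close> when the letters are sent to \<open>H\<close> by \<open>f\<close>. Both directions of the
  universal property are phrased with it: relations hold between the classes of the letters, and
  any \<open>f\<close> for which they hold extends to a homomorphism.\<close>

primrec eval_word :: "('a, 'c) monoid_scheme \<Rightarrow> ('g \<Rightarrow> 'a) \<Rightarrow> 'g word \<Rightarrow> 'a" where
  "eval_word H f [] = \<one>\<^bsub>H\<^esub>"
| "eval_word H f (l # w) =
     (if snd l then f (fst l) else inv\<^bsub>H\<^esub> (f (fst l))) \<otimes>\<^bsub>H\<^esub> eval_word H f w"

definition inverse_word :: "'g word \<Rightarrow> 'g word" where
  "inverse_word w = rev (map (\<lambda>(s, b). (s, \<not> b)) w)"

lemma words_simps [simp]: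
  "[] \<in> words S"
  "l # w \<in> words S \<longleftrightarrow> fst l \<in> S \<and> w \<in> words S"
  "v @ w \<in> words S \<longleftrightarrow> v \<in> words S \<and> w \<in> words S"
  by (auto simp: words_def mem_Times_iff)

lemma inverse_word_words [simp]: "w \<in> words S \<Longrightarrow> inverse_word w \<in> words S"
  by (auto simp: words_def inverse_word_def)

lemma word_eq_words: "word_eq S R v w \<Longrightarrow> v \<in> words S \<and> w \<in> words S"
  by (induction rule: word_eq.induct) auto

lemma word_eq_in_context:
  "word_eq S R v w \<Longrightarrow> a \<in> words S \<Longrightarrow> b \<in> words S \<Longrightarrow> word_eq S R (a @ v @ b) (a @ w @ b)"
proof (induction rule: word_eq.induct)
  case (cancel u v s c)
  then show ?case
    using word_eq.cancel[of "a @ u" S "v @ b" s R c] by simp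
next
  case (relation u v l r)
  then show ?case
    using word_eq.relation[of "a @ u" S "v @ b" l r R] by simp
qed (auto intro: word_eq.intros)

lemma word_eq_append:
  assumes "word_eq S R u u'" "word_eq S R v v'"
  shows "word_eq S R (u @ v) (u' @ v')"
proof -
  have "word_eq S R (u @ v) (u' @ v)"
    using word_eq_in_context[OF assms(1), of "[]" v] word_eq_words[OF assms(2)] by simp
  moreover have "word_eq S R (u' @ v) (u' @ v')"
    using word_eq_in_context[OF assms(2), of u' "[]"] word_eq_words[OF assms(1)] by simp
  ultimately show ?thesis by (rule word_eq.trans)
qed

lemma word_class_eq_iff:
  assumes "v \<in> words S"
  shows "word_class S R v = word_class S R w \<longleftrightarrow> word_eq S R v w"
proof
  assume "word_class S R v = word_class S R w"
  moreover have "v \<in> word_class S R v"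
    using assms by (simp add: word_class_def word_eq.refl)
  ultimately show "word_eq S R v w"
    by (simp add: word_class_def word_eq.sym)
qed (auto simp: word_class_def intro: word_eq.trans word_eq.sym)

lemma presented_group_carrier: "carrier (presented_group S R) = word_class S R ` words S"
  by (auto simp: presented_group_def word_class_def quotient_def)

lemma presented_group_mult:
  assumes "v \<in> words S" "w \<in> words S"
  shows "word_class S R v \<otimes>\<^bsub>presented_group S R\<^esub> word_class S R w = word_class S R (v @ w)"
  using assms
  by (auto simp: presented_group_def word_class_def
      intro: word_eq.trans word_eq_append word_eq.refl)

lemma presented_group_one: "\<one>\<^bsub>presented_group S R\<^esub> = word_class S R []"
  by (simp add: presented_group_def word_class_def)

lemma inverse_word_cancel: "w \<in> words S \<Longrightarrow> word_eq S R (inverse_word w @ w) []"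
proof (induction w)
  case Nil
  then show ?case by (simp add: inverse_word_def word_eq.refl)
next
  case (Cons l w)
  obtain s b where l: "l = (s, b)" by fastforce
  have "word_eq S R (inverse_word w @ [(s, \<not> b), (s, \<not> \<not> b)] @ w) (inverse_word w @ w)"
    using Cons.prems l by (intro word_eq.cancel) auto
  then show ?case
    using Cons l word_eq.trans by (fastforce simp: inverse_word_def)
qed

lemma presented_group_group: "group (presented_group S R)"
proof (rule groupI)
  fix x assume "x \<in> carrier (presented_group S R)"
  then obtain w where w: "w \<in> words S" "x = word_class S R w"
    by (auto simp: presented_group_carrier)
  then have "word_class S R (inverse_word w) \<otimes>\<^bsub>presented_group S R\<^esub> x = \<one>\<^bsub>presented_group S R\<^esub>"
    by (simp add: presented_group_mult presented_group_one word_class_eq_iff inverse_word_cancel)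
  then show "\<exists>y\<in>carrier (presented_group S R).
      y \<otimes>\<^bsub>presented_group S R\<^esub> x = \<one>\<^bsub>presented_group S R\<^esub>"
    using w by (auto simp: presented_group_carrier)
qed (auto simp: presented_group_carrier presented_group_mult presented_group_one)

abbreviation presented_gen :: "'g set \<Rightarrow> ('g word \<times> 'g word) set \<Rightarrow> 'g \<Rightarrow> 'g word set" where
  "presented_gen S R s \<equiv> word_class S R [(s, True)]"

lemma presented_gen_carrier: "s \<in> S \<Longrightarrow> presented_gen S R s \<in> carrier (presented_group S R)"
  by (auto simp: presented_group_carrier)

lemma inv_presented_gen:
  assumes "s \<in> S"
  shows "inv\<^bsub>presented_group S R\<^esub> (presented_gen S R s) = word_class S R [(s, False)]"
proof -
  have "word_eq S R ([] @ [(s, False), (s, \<not> False)] @ []) ([] @ [])"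
    using assms by (intro word_eq.cancel) auto
  then have "word_class S R [(s, False)] \<otimes>\<^bsub>presented_group S R\<^esub> presented_gen S R s
      = \<one>\<^bsub>presented_group S R\<^esub>"
    using assms by (simp add: presented_group_mult presented_group_one word_class_eq_iff)
  then show ?thesis
    using assms by (intro group.inv_equality[OF presented_group_group]) (auto simp: presented_group_carrier)
qed

lemma eval_presented_gen:
  "w \<in> words S \<Longrightarrow> eval_word (presented_group S R) (presented_gen S R) w = word_class S R w"
proof (induction w)
  case (Cons l w)
  then show ?case
    by (cases l) (auto simp: inv_presented_gen presented_group_mult)
qed (simp add: presented_group_one)

lemma presented_group_relation:
  assumes "(l, r) \<in> R" "l \<in> words S" "r \<in> words S"
  shows "eval_word (presented_group S R) (presented_gen S R) l
       = eval_word (presented_group S R) (presented_gen S R) r"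
  using word_eq.relation[of "[]" S "[]" l r R] assms
  by (simp add: eval_presented_gen word_class_eq_iff)

context group
begin

lemma eval_word_closed: "f \<in> S \<rightarrow> carrier G \<Longrightarrow> w \<in> words S \<Longrightarrow> eval_word G f w \<in> carrier G"
  by (induction w) auto

lemma eval_word_append:
  "f \<in> S \<rightarrow> carrier G \<Longrightarrow> v \<in> words S \<Longrightarrow> w \<in> words S \<Longrightarrow>
    eval_word G f (v @ w) = eval_word G f v \<otimes> eval_word G f w"
  by (induction v) (auto simp: eval_word_closed m_assoc Pi_iff)

lemma eval_word_cong_word_eq:
  assumes f: "f \<in> S \<rightarrow> carrier G"
    and R: "\<And>l r. (l, r) \<in> R \<Longrightarrow> l \<in> words S \<Longrightarrow> r \<in> words S \<Longrightarrow> eval_word G f l = eval_word G f r"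
  shows "word_eq S R v w \<Longrightarrow> eval_word G f v = eval_word G f w"
proof (induction rule: word_eq.induct)
  case (cancel u v s b)
  have [simp]: "f s \<in> carrier G" using cancel f by auto
  have "eval_word G f [(s, b), (s, \<not> b)] = \<one>" by (cases b) auto
  moreover have "[(s, b), (s, \<not> b)] \<in> words S" using cancel by simp
  ultimately show ?case
    using cancel f by (simp add: eval_word_append eval_word_closed del: eval_word.simps append.simps)
next
  case (relation u v l r)
  then show ?case using f R by (simp add: eval_word_append)
qed auto

text \<open>The universal property. Evaluation respects each of the steps that generate \<open>word_eq\<close>, so it
  takes the same value at every representative of a class, and the choice of one is harmless.\<close>

lemma presented_group_hom:
  assumes f: "f \<in> S \<rightarrow> carrier G"
    and R: "\<And>l r. (l, r) \<in> R \<Longrightarrow> l \<in> words S \<Longrightarrow> r \<in> words S \<Longrightarrow> eval_word G f l = eval_word G f r"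
  obtains h where "h \<in> hom (presented_group S R) G" "\<And>s. s \<in> S \<Longrightarrow> h (presented_gen S R s) = f s"
proof -
  define h where "h P = eval_word G f (SOME w. w \<in> P)" for P
  have h: "h (word_class S R w) = eval_word G f w" if "w \<in> words S" for w
  proof -
    have "w \<in> word_class S R w" using that by (simp add: word_class_def word_eq.refl)
    then have "(SOME v. v \<in> word_class S R w) \<in> word_class S R w" by (rule someI)
    then have "word_eq S R w (SOME v. v \<in> word_class S R w)" by (simp add: word_class_def)
    then show ?thesis
      unfolding h_def using eval_word_cong_word_eq[OF f R] by simp
  qed
  show thesis
  proof
    show "h \<in> hom (presented_group S R) G"
      by (auto simp: hom_def presented_group_carrier presented_group_mult h
          eval_word_closed[OF f] eval_word_append[OF f])
    show "h (presented_gen S R s) = f s" if "s \<in> S" for s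
      using that f by (simp add: h Pi_iff)
  qed
qed

end

lemma hom_eval_word:
  assumes "group G" "group H" "h \<in> hom G H" "f \<in> S \<rightarrow> carrier G" "w \<in> words S"
  shows "h (eval_word G f w) = eval_word H (\<lambda>s. h (f s)) w"
proof -
  interpret group_hom G H h using assms by (simp add: group_hom_def group_hom_axioms_def)
  show ?thesis
    using assms(5)
  proof (induction w)
    case (Cons l w)
    then have "f (fst l) \<in> carrier G" "eval_word G f w \<in> carrier G"
      using assms(4) G.eval_word_closed[OF assms(4)] by auto
    then show ?case using Cons by simp
  qed simp
qed

text \<open>The uniqueness half of the universal property: every element is the value of a word in the
  generators, and homomorphisms commute with evaluation.\<close>

lemma presented_group_hom_ext:
  assumes "group H" "g \<in> hom (presented_group S R) H" "h \<in> hom (presented_group S R) H"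
    and "\<And>s. s \<in> S \<Longrightarrow> g (presented_gen S R s) = h (presented_gen S R s)"
    and "x \<in> carrier (presented_group S R)"
  shows "g x = h x"
proof -
  obtain w where w: "w \<in> words S" "x = eval_word (presented_group S R) (presented_gen S R) w"
    using assms(5) by (auto simp: presented_group_carrier eval_presented_gen)
  have gens: "presented_gen S R \<in> S \<rightarrow> carrier (presented_group S R)"
    by (simp add: presented_gen_carrier)
  have "eval_word H (\<lambda>s. g (presented_gen S R s)) w = eval_word H (\<lambda>s. h (presented_gen S R s)) w"
    using w(1) assms(4) by (induction w) auto
  then show ?thesis
    using w hom_eval_word[OF presented_group_group assms(1) _ gens w(1)] assms(2,3) by simp
qed


section \<open>Homomorphisms out of $\pi_1(\mathbb{Z}_2, Y)$\<close>

text \<open>By default the simplifier turns sums and products of bits into truth values of compound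
  conditions, which destroys the linear algebra over \<open>bit\<close> needed below.\<close>

declare add_bit_eq_xor [simp del] mult_bit_eq_and [simp del]

lemma (in group) involutions_commute:
  assumes "x \<in> carrier G" "y \<in> carrier G" "x \<otimes> x = \<one>" "y \<otimes> y = \<one>"
    and "(x \<otimes> y) \<otimes> (x \<otimes> y) = \<one>"
  shows "x \<otimes> y = y \<otimes> x"
proof -
  have "inv (x \<otimes> y) = x \<otimes> y" using assms by (intro inv_equality) auto
  moreover have "inv x = x" "inv y = y" using assms by (auto intro: inv_equality)
  ultimately show ?thesis using assms(1,2) by (simp add: inv_mult_group)
qed

lemma (in group) commutator_eq_one:
  assumes "x \<in> carrier G" "y \<in> carrier G" "x \<otimes> y = y \<otimes> x"
  shows "x \<otimes> (y \<otimes> (inv x \<otimes> inv y)) = \<one>"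
proof -
  have "inv x \<otimes> inv y = inv (x \<otimes> y)"
    using assms by (simp add: inv_mult_group[symmetric])
  then show ?thesis using assms(1,2) by (simp add: m_assoc[symmetric])
qed

abbreviation pi1_gen :: "'a sset \<Rightarrow> 'a \<Rightarrow> 'a word set" where
  "pi1_gen Y u \<equiv> presented_gen (simplices Y 1) (pi1_relations Y) u"

lemma pi1_Z2_group: "group (pi1_Z2 Y)"
  by (simp add: pi1_Z2_def presented_group_group)

lemma pi1_gen_carrier: "u \<in> simplices Y 1 \<Longrightarrow> pi1_gen Y u \<in> carrier (pi1_Z2 Y)"
  by (simp add: pi1_Z2_def presented_gen_carrier)

lemma pi1_gen_square:
  assumes "u \<in> simplices Y 1"
  shows "pi1_gen Y u \<otimes>\<^bsub>pi1_Z2 Y\<^esub> pi1_gen Y u = \<one>\<^bsub>pi1_Z2 Y\<^esub>"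
proof -
  interpret group "pi1_Z2 Y" by (rule pi1_Z2_group)
  have "([(u, True), (u, True)], []) \<in> pi1_relations Y"
    using assms by (auto simp: pi1_relations_def)
  from presented_group_relation[OF this, of "simplices Y 1", folded pi1_Z2_def]
  show ?thesis using assms pi1_gen_carrier[OF assms] by simp
qed

lemma pi1_gen_face:
  assumes "\<sigma> \<in> simplices Y 2" "\<And>i. i \<le> 2 \<Longrightarrow> face Y 2 i \<sigma> \<in> simplices Y 1"
  shows "pi1_gen Y (face Y 2 2 \<sigma>) \<otimes>\<^bsub>pi1_Z2 Y\<^esub> pi1_gen Y (face Y 2 0 \<sigma>) = pi1_gen Y (face Y 2 1 \<sigma>)"
proof -
  interpret group "pi1_Z2 Y" by (rule pi1_Z2_group)
  have "([(face Y 2 2 \<sigma>, True), (face Y 2 0 \<sigma>, True)], [(face Y 2 1 \<sigma>, True)]) \<in> pi1_relations Y"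
    using assms(1) unfolding pi1_relations_def by blast
  from presented_group_relation[OF this, of "simplices Y 1", folded pi1_Z2_def]
  show ?thesis
    using assms(2)[of 0] assms(2)[of 1] assms(2)[of 2]
      assms(2)[THEN pi1_gen_carrier, of 0] assms(2)[THEN pi1_gen_carrier, of 1]
      assms(2)[THEN pi1_gen_carrier, of 2]
    by simp
qed

text \<open>
  On a triangle, $e_{d_2} e_{d_0} = e_{d_1}$ says that a product of two involutions is an involution.
  So the values at $d_2$ and $d_0$ commute, and the value at $d_1$, their product, commutes with both.
  This turns the squares and products into all the relations of \<open>pi1_Z2\<close>.
\<close>

lemma (in group) pi1_Z2_hom:
  assumes faces: "\<And>\<sigma> i. \<sigma> \<in> simplices Y 2 \<Longrightarrow> i \<le> 2 \<Longrightarrow> face Y 2 i \<sigma> \<in> simplices Y 1"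
    and f: "f \<in> simplices Y 1 \<rightarrow> carrier G"
    and sq: "\<And>u. u \<in> simplices Y 1 \<Longrightarrow> f u \<otimes> f u = \<one>"
    and mul: "\<And>\<sigma>. \<sigma> \<in> simplices Y 2 \<Longrightarrow> f (face Y 2 2 \<sigma>) \<otimes> f (face Y 2 0 \<sigma>) = f (face Y 2 1 \<sigma>)"
  obtains h where "h \<in> hom (pi1_Z2 Y) G" "\<And>u. u \<in> simplices Y 1 \<Longrightarrow> h (pi1_gen Y u) = f u"
proof -
  have rel: "eval_word G f l = eval_word G f r" if "(l, r) \<in> pi1_relations Y" for l r
    using that unfolding pi1_relations_def
  proof (elim UnE CollectE exE conjE)
    fix u assume "(l, r) = ([(u, True), (u, True)], [])" "u \<in> simplices Y 1"
    then show ?thesis using f sq[of u] by (auto simp: Pi_iff)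
  next
    fix \<sigma> and i j :: nat
    assume lr: "(l, r) = ([(face Y 2 i \<sigma>, True), (face Y 2 j \<sigma>, True),
        (face Y 2 i \<sigma>, False), (face Y 2 j \<sigma>, False)], [])"
      and \<sigma>: "\<sigma> \<in> simplices Y 2" and ij: "i \<in> {0, 1, 2}" "j \<in> {0, 1, 2}"
    define a where "a = (\<lambda>i. f (face Y 2 i \<sigma>))"
    have cl [simp]: "a k \<in> carrier G" if "k \<le> 2" for k
      using f faces[OF \<sigma> that] by (auto simp: a_def)
    have inv: "a k \<otimes> a k = \<one>" if "k \<le> 2" for k
      using sq faces[OF \<sigma> that] by (auto simp: a_def)
    have a1: "a 2 \<otimes> a 0 = a 1" using mul[OF \<sigma>] by (simp add: a_def)
    have 20: "a 2 \<otimes> a 0 = a 0 \<otimes> a 2"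
      using inv[of 1] by (intro involutions_commute) (auto simp: a1 inv)
    have "a 0 \<otimes> a 1 = a 1 \<otimes> a 0" "a 2 \<otimes> a 1 = a 1 \<otimes> a 2"
      unfolding a1[symmetric] by (simp_all add: 20 m_assoc) (simp_all add: 20 m_assoc[symmetric])
    with 20 have "a i \<otimes> a j = a j \<otimes> a i" using ij by auto
    moreover have "i \<le> 2" "j \<le> 2" using ij by auto
    moreover have "eval_word G f l = a i \<otimes> (a j \<otimes> (inv (a i) \<otimes> inv (a j)))"
      using lr cl[OF \<open>i \<le> 2\<close>] cl[OF \<open>j \<le> 2\<close>] by (simp add: a_def)
    ultimately show ?thesis
      using lr commutator_eq_one[of "a i" "a j"] by simp
  next
    fix \<sigma>
    assume lr: "(l, r) = ([(face Y 2 2 \<sigma>, True), (face Y 2 0 \<sigma>, True)], [(face Y 2 1 \<sigma>, True)])"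
      and \<sigma>: "\<sigma> \<in> simplices Y 2"
    have "f (face Y 2 k \<sigma>) \<in> carrier G" if "k \<le> 2" for k
      using f faces[OF \<sigma> that] by auto
    then show ?thesis using lr mul[OF \<sigma>] by simp
  qed
  show thesis
    using presented_group_hom[OF f rel] that unfolding pi1_Z2_def by blast
qed


lemma pi1_Z2_hom_ext:
  assumes "group H" "g \<in> hom (pi1_Z2 Y) H" "h \<in> hom (pi1_Z2 Y) H"
    and "\<And>u. u \<in> simplices Y 1 \<Longrightarrow> g (pi1_gen Y u) = h (pi1_gen Y u)"
    and "x \<in> carrier (pi1_Z2 Y)"
  shows "g x = h x"
  using presented_group_hom_ext assms unfolding pi1_Z2_def by blast



section \<open>The group of a Mermin square\<close>

definition bit_pow :: "('a, 'c) monoid_scheme \<Rightarrow> 'a \<Rightarrow> bit \<Rightarrow> 'a" where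
  "bit_pow G g b = (if b = 0 then \<one>\<^bsub>G\<^esub> else g)"

lemma bit_pow_0 [simp]: "bit_pow G g 0 = \<one>\<^bsub>G\<^esub>"
  and bit_pow_1 [simp]: "bit_pow G g 1 = g"
  by (simp_all add: bit_pow_def)

context group
begin

lemma bit_pow_closed [simp]: "g \<in> carrier G \<Longrightarrow> bit_pow G g b \<in> carrier G"
  by (simp add: bit_pow_def)

lemma bit_pow_add:
  assumes "g \<in> carrier G" "g \<otimes> g = \<one>"
  shows "bit_pow G g a \<otimes> bit_pow G g b = bit_pow G g (a + b)"
  using assms by (cases a; cases b) simp_all

text \<open>The exponents make commutation up to a central involution \<open>z\<close> bilinear. This one rule, with
  \<open>c = 0\<close> for commuting pairs, lets the simplifier sort products of powers of generators.\<close>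

lemma bit_pow_twisted_commute:
  assumes "z \<in> carrier G" "x \<in> carrier G" "y \<in> carrier G"
    and "x \<otimes> y = bit_pow G z c \<otimes> (y \<otimes> x)"
  shows "bit_pow G x a \<otimes> bit_pow G y b = bit_pow G z (c * a * b) \<otimes> (bit_pow G y b \<otimes> bit_pow G x a)"
  using assms by (cases a; cases b) simp_all

end

text \<open>
  The tuple \<open>(j, p, q, r, s)\<close> stands for $J^j A^p B^q C^r D^s$, where \<open>J\<close> is central,
  $BA = J^c AB$, $DC = J^c CD$, and all other pairs of the involutions commute; the term
  \<open>c * (q * p' + s * r')\<close> counts the exchanges needed to sort a product. For \<open>c = 0\<close> this is
  the vector space $\mathbb{Z}_2^5$; for \<open>c = 1\<close> it is the extraspecial group $2^{1+4}_+$, the real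
  Pauli group on two qubits.
\<close>

definition square_group :: "bit \<Rightarrow> (bit \<times> bit \<times> bit \<times> bit \<times> bit) monoid" where
  "square_group c =
     \<lparr>carrier = UNIV,
      mult = (\<lambda>(j, p, q, r, s) (j', p', q', r', s').
        (j + j' + c * (q * p' + s * r'), p + p', q + q', r + r', s + s')),
      one = (0, 0, 0, 0, 0)\<rparr>"

lemma square_group_simps [simp]:
  "carrier (square_group c) = UNIV"
  "(j, p, q, r, s) \<otimes>\<^bsub>square_group c\<^esub> (j', p', q', r', s')
     = (j + j' + c * (q * p' + s * r'), p + p', q + q', r + r', s + s')"
  "\<one>\<^bsub>square_group c\<^esub> = (0, 0, 0, 0, 0)"
  by (simp_all add: square_group_def)

lemma square_group_group: "group (square_group c)"
proof (rule groupI)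
  fix x assume "x \<in> carrier (square_group c)"
  obtain j p q r s where "x = (j, p, q, r, s)" by (cases x)
  then have "(j + c * (q * p + s * r), p, q, r, s) \<otimes>\<^bsub>square_group c\<^esub> x = \<one>\<^bsub>square_group c\<^esub>"
    by (cases j; cases c; cases p; cases q; cases r; cases s) simp_all
  then show "\<exists>y\<in>carrier (square_group c). y \<otimes>\<^bsub>square_group c\<^esub> x = \<one>\<^bsub>square_group c\<^esub>" 
    by (intro bexI) simp_all
next
  show "x \<otimes>\<^bsub>square_group c\<^esub> y \<otimes>\<^bsub>square_group c\<^esub> z
      = x \<otimes>\<^bsub>square_group c\<^esub> (y \<otimes>\<^bsub>square_group c\<^esub> z)" for x y z
    by (cases x; cases y; cases z) (simp only: square_group_simps prod.inject algebra_simps simp_thms)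
qed auto

locale square_generators = group +
  fixes J A B C D and c :: bit
  assumes closed: "J \<in> carrier G" "A \<in> carrier G" "B \<in> carrier G" "C \<in> carrier G" "D \<in> carrier G"
    and square: "J \<otimes> J = \<one>" "A \<otimes> A = \<one>" "B \<otimes> B = \<one>" "C \<otimes> C = \<one>" "D \<otimes> D = \<one>"
    and central: "A \<otimes> J = J \<otimes> A" "B \<otimes> J = J \<otimes> B" "C \<otimes> J = J \<otimes> C" "D \<otimes> J = J \<otimes> D"
    and commute: "C \<otimes> A = A \<otimes> C" "D \<otimes> A = A \<otimes> D" "C \<otimes> B = B \<otimes> C" "D \<otimes> B = B \<otimes> D"
    and twisted: "B \<otimes> A = bit_pow G J c \<otimes> (A \<otimes> B)" "D \<otimes> C = bit_pow G J c \<otimes> (C \<otimes> D)"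
begin

definition normal_form :: "bit \<times> bit \<times> bit \<times> bit \<times> bit \<Rightarrow> 'a" where
  "normal_form = (\<lambda>(j, p, q, r, s). bit_pow G J j \<otimes> (bit_pow G A p \<otimes> (bit_pow G B q \<otimes>
     (bit_pow G C r \<otimes> bit_pow G D s))))"

text \<open>Sorting the product of two normal forms with the relations of the locale reproduces the
  multiplication of \<open>square_group c\<close>, which is therefore the largest group with five such
  generators.\<close>

lemma normal_form_hom: "normal_form \<in> hom (square_group c) G"
proof (rule homI)
  note add = bit_pow_add[OF closed(1) square(1)] bit_pow_add[OF closed(2) square(2)]
    bit_pow_add[OF closed(3) square(3)] bit_pow_add[OF closed(4) square(4)]
    bit_pow_add[OF closed(5) square(5)]
  have comm: "bit_pow G x a \<otimes> bit_pow G y b = bit_pow G y b \<otimes> bit_pow G x a"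
    if "x \<otimes> y = y \<otimes> x" "x \<in> carrier G" "y \<in> carrier G" for x y a b
    using bit_pow_twisted_commute[of J x y 0 a b] that closed by simp
  have lc: "bit_pow G x a \<otimes> (bit_pow G y b \<otimes> w) = bit_pow G y b \<otimes> (bit_pow G x a \<otimes> w)"
    if "x \<otimes> y = y \<otimes> x" "x \<in> carrier G" "y \<in> carrier G" "w \<in> carrier G" for x y a b w
    using that comm[OF that(1,2,3)] by (simp add: m_assoc[symmetric])
  have la: "bit_pow G x a \<otimes> (bit_pow G x b \<otimes> w) = bit_pow G x (a + b) \<otimes> w"
    if "x \<otimes> x = \<one>" "x \<in> carrier G" "w \<in> carrier G" for x a b w
    using that bit_pow_add[of x a b] by (simp add: m_assoc[symmetric])
  have lt: "bit_pow G x a \<otimes> (bit_pow G y b \<otimes> w)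
      = bit_pow G J (c * a * b) \<otimes> (bit_pow G y b \<otimes> (bit_pow G x a \<otimes> w))"
    if "x \<otimes> y = bit_pow G J c \<otimes> (y \<otimes> x)" "x \<in> carrier G" "y \<in> carrier G" "w \<in> carrier G" for x y a b w
    using that closed bit_pow_twisted_commute[OF _ that(2,3,1), of a b] by (simp add: m_assoc[symmetric])
  fix u v :: "bit \<times> bit \<times> bit \<times> bit \<times> bit"
  obtain j p q r s j' p' q' r' s' where "u = (j, p, q, r, s)" "v = (j', p', q', r', s')"
    by (cases u, cases v)
  then show "normal_form (u \<otimes>\<^bsub>square_group c\<^esub> v) = normal_form u \<otimes> normal_form v"
    by (simp add: normal_form_def closed m_assoc square add
      central[THEN lc] commute[THEN lc] twisted[THEN lt] la
      commute[THEN comm] central[THEN comm])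
     (simp add: algebra_simps)
next
  show "normal_form v \<in> carrier G" for v
    by (cases v) (simp add: normal_form_def closed)
qed

end

text \<open>
  Mermin's argument for the square
  with the rows $(A, C, t_1)$, $(D, B, t_2)$ and $(s_1, s_2, z_2)$,
  in which the product of each row and column is a prescribed power of \<open>J\<close>. Entries in a common
  line commute, because their product is again an involution up to \<open>J\<close>. Expanding the corner $z_2$
  along the last column gives $A C D B$ and along the last row $A D C B$, up to powers of \<open>J\<close>;
  cancelling \<open>A\<close> and \<open>B\<close>, the entries \<open>C\<close> and \<open>D\<close> commute up to $J^c$, with \<open>c\<close> the sum of
  all six exponents. Then $z_2^2 = 1$ forces $(AB)^2 = J^c$, so \<open>A\<close> and \<open>B\<close> commute up to the
  same power.
\<close>

lemma (in group) mermin_square: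
  assumes closed: "J \<in> carrier G" "A \<in> carrier G" "B \<in> carrier G" "C \<in> carrier G" "D \<in> carrier G"
    and JJ: "J \<otimes> J = \<one>"
    and central: "\<And>x. x \<in> {A, B, C, D} \<Longrightarrow> x \<otimes> J = J \<otimes> x"
    and squares: "\<And>x. x \<in> {A, B, C, D, t1, t2, s1, s2, z2} \<Longrightarrow> x \<otimes> x = \<one>"
    and rows: "bit_pow G J g1 \<otimes> (A \<otimes> C) = t1" "bit_pow G J g3 \<otimes> (D \<otimes> B) = t2"
      "bit_pow G J g5 \<otimes> (s1 \<otimes> s2) = z2"
    and cols: "bit_pow G J g4 \<otimes> (A \<otimes> D) = s1" "bit_pow G J g6 \<otimes> (C \<otimes> B) = s2"
      "bit_pow G J g2 \<otimes> (t1 \<otimes> t2) = z2"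
  shows "square_generators G J A B C D (g1 + g2 + g3 + g4 + g5 + g6)"
proof -
  define K where "K = bit_pow G J"
  have K [simp]: "K e \<in> carrier G" for e using closed by (simp add: K_def)
  have KK: "K a \<otimes> K b = K (a + b)" for a b using closed JJ by (simp add: K_def bit_pow_add)
  have KK': "K a \<otimes> (K b \<otimes> x) = K (a + b) \<otimes> x" if "x \<in> carrier G" for a b x
    using that by (simp add: m_assoc[symmetric] KK)
  have K0 [simp]: "K 0 = \<one>" by (simp add: K_def)
  have Kx: "x \<otimes> K e = K e \<otimes> x" if "x \<in> {A, B, C, D}" for x e
    using that central[OF that] closed by (cases e) (auto simp: K_def)
  have Kx': "x \<otimes> (K e \<otimes> y) = K e \<otimes> (x \<otimes> y)" if "x \<in> {A, B, C, D}" "y \<in> carrier G" for x y e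
  proof -
    have "x \<in> carrier G" using that(1) closed by auto
    then show ?thesis using that Kx[of x e] by (simp add: m_assoc[symmetric])
  qed
  note K_simps = KK KK' Kx Kx' bit_add_self
  note rels = rows[folded K_def] cols[folded K_def]
  have commute: "x \<otimes> y = y \<otimes> x"
    if "x \<in> {A, B, C, D}" "y \<in> {A, B, C, D}" "w = K g \<otimes> (x \<otimes> y)" "w \<otimes> w = \<one>" for x y w g
  proof -
    have cl: "x \<in> carrier G" "y \<in> carrier G" using that closed by auto
    then have "(x \<otimes> y) \<otimes> (x \<otimes> y) = w \<otimes> w"
      using that(1,2) unfolding that(3) by (simp add: m_assoc K_simps)
    with that show ?thesis using cl squares[of x] squares[of y] that(1,2)
      by (intro involutions_commute) auto
  qed
  have AC: "A \<otimes> C = C \<otimes> A" by (rule commute[of _ _ t1 g1]) (auto simp: rels squares)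
  have DB: "D \<otimes> B = B \<otimes> D" by (rule commute[of _ _ t2 g3]) (auto simp: rels squares)
  have AD: "A \<otimes> D = D \<otimes> A" by (rule commute[of _ _ s1 g4]) (auto simp: rels squares)
  have CB: "C \<otimes> B = B \<otimes> C" by (rule commute[of _ _ s2 g6]) (auto simp: rels squares)
  define e1 where "e1 = g1 + g2 + g3"
  define e2 where "e2 = g4 + g5 + g6"
  define c where "c = e1 + e2"
  have col: "z2 = K e1 \<otimes> (A \<otimes> (C \<otimes> (D \<otimes> B)))"
    using closed by (simp add: rels(6)[symmetric] rels(1,2)[symmetric] m_assoc K_simps e1_def add_ac)
  have row: "z2 = K e2 \<otimes> (A \<otimes> (D \<otimes> (C \<otimes> B)))"
    using closed by (simp add: rels(3)[symmetric] rels(4,5)[symmetric] m_assoc K_simps e2_def add_ac)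
  have "K e1 \<otimes> z2 = A \<otimes> (C \<otimes> (D \<otimes> B))"
    unfolding col using closed by (simp add: K_simps)
  moreover have "K e1 \<otimes> z2 = A \<otimes> (K c \<otimes> (D \<otimes> (C \<otimes> B)))"
    unfolding row using closed by (simp add: K_simps c_def)
  ultimately have "C \<otimes> (D \<otimes> B) = K c \<otimes> (D \<otimes> (C \<otimes> B))"
    using closed Units_l_cancel[of A "C \<otimes> (D \<otimes> B)" "K c \<otimes> (D \<otimes> (C \<otimes> B))"] by (simp add: Units_eq)
  then have "(C \<otimes> D) \<otimes> B = (K c \<otimes> (D \<otimes> C)) \<otimes> B"
    using closed by (simp add: m_assoc)
  then have CD: "C \<otimes> D = K c \<otimes> (D \<otimes> C)"
    using closed by simp
  then have DC: "D \<otimes> C = K c \<otimes> (C \<otimes> D)"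
    using closed by (simp add: K_simps)
  have sq: "x \<otimes> (x \<otimes> w) = w" if "x \<in> {A, B, C, D}" "w \<in> carrier G" for x w
  proof -
    have "x \<in> carrier G" using that(1) closed by auto
    moreover have "x \<otimes> x = \<one>" using that(1) by (intro squares) auto
    ultimately show ?thesis using that(2) by (simp add: m_assoc[symmetric])
  qed
  have z2a: "z2 = K e1 \<otimes> (C \<otimes> (A \<otimes> (B \<otimes> D)))"
    unfolding col DB using closed AC by (simp add: m_assoc[symmetric])
  have "A \<otimes> (D \<otimes> (C \<otimes> B)) = D \<otimes> (A \<otimes> (B \<otimes> C))"
    unfolding CB using closed AD by (simp add: m_assoc[symmetric])
  then have z2b: "z2 = K e2 \<otimes> (D \<otimes> (A \<otimes> (B \<otimes> C)))"
    using row by simp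
  \<comment> \<open>One copy of \<open>z2\<close> is written along the column, the other along the row, ordered so that
    the two \<open>D\<close>'s become adjacent and cancel; conjugation by \<open>C\<close> then removes the outer pair.\<close>
  have "\<one> = z2 \<otimes> z2" by (simp add: squares)
  also have "\<dots> = K c \<otimes> (C \<otimes> (A \<otimes> (B \<otimes> (A \<otimes> (B \<otimes> C)))))"
    by (subst z2a, subst z2b) (use closed in \<open>simp add: m_assoc K_simps sq c_def\<close>)
  finally have one: "\<one> = K c \<otimes> (C \<otimes> (A \<otimes> (B \<otimes> (A \<otimes> (B \<otimes> C)))))" .
  have "C \<otimes> (\<one> \<otimes> C) = C \<otimes> ((K c \<otimes> (C \<otimes> (A \<otimes> (B \<otimes> (A \<otimes> (B \<otimes> C)))))) \<otimes> C)"
    by (simp only: one[symmetric])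
  then have AB: "K c \<otimes> (A \<otimes> (B \<otimes> (A \<otimes> B))) = \<one>"
    using closed squares[of C] by (simp add: m_assoc K_simps sq)
  have "(B \<otimes> A) \<otimes> \<one> = K c \<otimes> (A \<otimes> B)"
    unfolding AB[symmetric] using closed by (simp add: m_assoc K_simps sq)
  then have BA: "B \<otimes> A = K c \<otimes> (A \<otimes> B)" using closed by simp
  have "c = g1 + g2 + g3 + g4 + g5 + g6"
    by (simp add: c_def e1_def e2_def add_ac)
  then show ?thesis
    using closed JJ central[of A] central[of B] central[of C] central[of D]
      squares[of A] squares[of B] squares[of C] squares[of D] AC DB AD CB BA DC
    by unfold_locales (simp_all add: K_def)
qed


section \<open>Low-dimensional simplices of the twisted torus\<close>

text \<open>The 1-simplices of the torus, with a vertex standing for the degenerate edge at it. Accordingly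
  \<open>source\<close> and \<open>target\<close> fix vertices, so that the degenerate triangles over vertices need no
  separate treatment.\<close>

definition edge :: "torus_cell \<Rightarrow> torus_cell \<times> nat list" where
  "edge c = (c, if cell_dim c = 0 then [0, 0] else [0, 1])"

definition source :: "torus_cell \<Rightarrow> torus_cell" where
  "source c = (if cell_dim c = 0 then c else cell_faces c ! 1)"

definition target :: "torus_cell \<Rightarrow> torus_cell" where
  "target c = (if cell_dim c = 0 then c else cell_faces c ! 0)"

lemma fst_edge [simp]: "fst (edge c) = c"
  by (simp add: edge_def)

lemma cell_dim_source: "cell_dim c = 1 \<Longrightarrow> cell_dim (source c) = 0"
  by (cases c) (simp_all add: cell_dim_def source_def)

lemma cell_dim_target: "cell_dim c = 1 \<Longrightarrow> cell_dim (target c) = 0"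
  by (cases c) (simp_all add: cell_dim_def target_def)

lemma cell_dim_face:
  assumes "cell_dim c = 2" "i \<le> 2"
  shows "cell_dim (cell_faces c ! i) = 1"
proof -
  have "i = 0 \<or> i = 1 \<or> i = 2" using assms(2) by linarith
  then show ?thesis using assms(1) by (cases c) (auto simp: cell_dim_def)
qed

lemma torus_simplices1: "simplices torus 1 = {edge c | c. cell_dim c \<le> 1}"
proof (intro subset_antisym subsetI)
  fix u assume "u \<in> simplices torus 1"
  then obtain c w where u: "u = (c, w)" and w: "length w = 2" "sorted w" "set w = {0..cell_dim c}"
    by (auto simp: torus_def numeral_2_eq_2)
  obtain a b where ab: "w = [a, b]"
    using w(1) by (auto simp: length_Suc_conv numeral_2_eq_2)
  have "card (set w) \<le> 2" using w(1) card_length[of w] by simp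
  then have "cell_dim c \<le> 1" using w(3) by simp
  moreover from this consider "cell_dim c = 0" | "cell_dim c = 1" by linarith
  then have "u = edge c"
  proof cases
    case 1
    then show ?thesis using w(3) by (simp add: u ab edge_def)
  next
    case 2
    then have "{a, b} = {0, 1}" using w(3) by (simp add: ab atLeastAtMost_insertL[symmetric])
    then show ?thesis using 2 w(2) by (auto simp: u ab edge_def doubleton_eq_iff)
  qed
  ultimately show "u \<in> {edge c | c. cell_dim c \<le> 1}" by blast
next
  fix u assume "u \<in> {edge c | c. cell_dim c \<le> 1}"
  then obtain c where u: "u = edge c" "cell_dim c \<le> 1" by blast
  from u(2) consider "cell_dim c = 0" | "cell_dim c = 1" by linarith
  then show "u \<in> simplices torus 1"
    by cases (auto simp: u(1) torus_def edge_def)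
qed

lemma torus_triangle_mem:
  "cell_dim c = 2 \<Longrightarrow> nondeg c \<in> simplices torus 2"
  "cell_dim c \<le> 1 \<Longrightarrow> j \<le> 1 \<Longrightarrow> degen torus 1 j (edge c) \<in> simplices torus 2"
proof -
  show "nondeg c \<in> simplices torus 2" if "cell_dim c = 2"
    using that by (auto simp: nondeg_def torus_def numeral_2_eq_2)
  show "degen torus 1 j (edge c) \<in> simplices torus 2" if "cell_dim c \<le> 1" "j \<le> 1"
    using simplicial_set.degen_closed[OF simplicial_set_torus, of "edge c" 1 j] that torus_simplices1
    by (auto simp: numeral_2_eq_2)
qed

lemma torus_triangle_cases:
  assumes "\<sigma> \<in> simplices torus 2"
  obtains (nondegenerate) c where "cell_dim c = 2" "\<sigma> = nondeg c"
  | (left) c where "cell_dim c \<le> 1" "\<sigma> = degen torus 1 0 (edge c)"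
  | (right) c where "cell_dim c \<le> 1" "\<sigma> = degen torus 1 1 (edge c)"
  using assms
proof (cases rule: torus_simplices2)
  case (1 c)
  then show thesis by (rule nondegenerate)
next
  case (2 c a b)
  then have "(c, [a, b]) = edge c" "cell_dim c \<le> 1"
    by (auto simp: torus_simplices1 edge_def simp del: One_nat_def)
  moreover from this(1) have "\<sigma> = degen torus 1 0 (edge c)"
    using 2(2) by (simp add: torus_def flip: \<open>(c, [a, b]) = edge c\<close>)
  ultimately show thesis using left by blast
next
  case (3 c a b)
  then have "(c, [a, b]) = edge c" "cell_dim c \<le> 1"
    by (auto simp: torus_simplices1 edge_def simp del: One_nat_def)
  moreover from this(1) have "\<sigma> = degen torus 1 1 (edge c)"
    using 3(2) by (simp add: torus_def flip: \<open>(c, [a, b]) = edge c\<close>)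
  ultimately show thesis using right by blast
qed

lemma nondeg_face:
  assumes "cell_dim c = 2" "i \<le> 2"
  shows "face torus 2 i (nondeg c) = edge (cell_faces c ! i)"
proof -
  have "i = 0 \<or> i = 1 \<or> i = 2" using assms(2) by linarith
  then show ?thesis
    using cell_dim_face[OF assms] assms(1)
    by (auto simp: nondeg_def face_torus_Let edge_def numeral_2_eq_2)
qed

lemma degen_edge_face:
  assumes "cell_dim c \<le> 1"
  shows "face torus 2 2 (degen torus 1 0 (edge c)) = edge (source c)"
    and "face torus 2 0 (degen torus 1 0 (edge c)) = edge c"
    and "face torus 2 1 (degen torus 1 0 (edge c)) = edge c"
    and "face torus 2 2 (degen torus 1 1 (edge c)) = edge c"
    and "face torus 2 0 (degen torus 1 1 (edge c)) = edge (target c)"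
    and "face torus 2 1 (degen torus 1 1 (edge c)) = edge c"
proof -
  have "cell_dim c = 0 \<or> cell_dim c = 1" using assms by linarith
  moreover have "degen torus 1 j (c, w) = (c, take (Suc j) w @ drop j w)" for j w
    by (simp add: torus_def)
  ultimately show "face torus 2 2 (degen torus 1 0 (edge c)) = edge (source c)"
    "face torus 2 0 (degen torus 1 0 (edge c)) = edge c"
    "face torus 2 1 (degen torus 1 0 (edge c)) = edge c"
    "face torus 2 2 (degen torus 1 1 (edge c)) = edge c"
    "face torus 2 0 (degen torus 1 1 (edge c)) = edge (target c)"
    "face torus 2 1 (degen torus 1 1 (edge c)) = edge c"
    using cell_dim_source[of c] cell_dim_target[of c]
    by (auto simp: edge_def face_torus_Let source_def target_def numeral_2_eq_2)
qed

lemma twisted_edges: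
  "simplices (twisted_product torus \<gamma>) 1 = {([a], edge c) | a c. cell_dim c \<le> 1}"
  unfolding twisted_product_def nerve_Z2_def using torus_simplices1
  by (auto simp: length_Suc_conv)

lemma twisted_triangles:
  "simplices (twisted_product torus \<gamma>) 2 = {([a, b], \<sigma>) | a b \<sigma>. \<sigma> \<in> simplices torus 2}"
  unfolding twisted_product_def nerve_Z2_def
  by (auto simp: length_Suc_conv numeral_2_eq_2)

lemma twisted_triangle_faces:
  "face (twisted_product torus \<gamma>) 2 2 ([a, b], \<sigma>) = ([a], face torus 2 2 \<sigma>)"
  "face (twisted_product torus \<gamma>) 2 0 ([a, b], \<sigma>) = ([\<gamma> \<sigma> + b], face torus 2 0 \<sigma>)"
  "face (twisted_product torus \<gamma>) 2 1 ([a, b], \<sigma>) = ([a + b], face torus 2 1 \<sigma>)"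
proof -
  have "subsimplex torus 2 {0, 1, 2} \<sigma> = \<sigma>"
    by (simp add: subsimplex_def numeral_2_eq_2)
  then have "twist torus \<gamma> 2 \<sigma> = [\<gamma> \<sigma>]"
    by (simp add: twist_def numeral_2_eq_2)
  then show "face (twisted_product torus \<gamma>) 2 2 ([a, b], \<sigma>) = ([a], face torus 2 2 \<sigma>)"
    "face (twisted_product torus \<gamma>) 2 0 ([a, b], \<sigma>) = ([\<gamma> \<sigma> + b], face torus 2 0 \<sigma>)"
    "face (twisted_product torus \<gamma>) 2 1 ([a, b], \<sigma>) = ([a + b], face torus 2 1 \<sigma>)"
    by (simp_all add: twisted_product_def nerve_Z2_def)
qed

lemma twisted_face_closed:
  assumes "\<rho> \<in> simplices (twisted_product torus \<gamma>) 2" "i \<le> 2"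
  shows "face (twisted_product torus \<gamma>) 2 i \<rho> \<in> simplices (twisted_product torus \<gamma>) 1"
proof -
  interpret simplicial_set torus by (rule simplicial_set_torus)
  obtain a b \<sigma> where \<rho>: "\<rho> = ([a, b], \<sigma>)" "\<sigma> \<in> simplices torus 2"
    using assms(1) by (auto simp: twisted_triangles)
  have "face torus 2 i \<sigma> \<in> simplices torus 1"
    using face_closed[of \<sigma> 1 i] \<rho>(2) assms(2) by (simp add: numeral_2_eq_2)
  then obtain c where c: "cell_dim c \<le> 1" "face torus 2 i \<sigma> = edge c"
    unfolding torus_simplices1 by blast
  have "i = 0 \<or> i = 1 \<or> i = 2" using assms(2) by linarith
  then show ?thesis
    using c unfolding \<rho>(1) twisted_edges by (elim disjE) (simp_all only: twisted_triangle_faces, blast+)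
qed

text \<open>
  The image of the edge generators in \<open>square_group\<close>. The four edges $z_1, z_3, x, y$ become the
  generators \<open>A\<close>, \<open>B\<close>, \<open>C\<close>, \<open>D\<close>, and the values at the other five are forced by all triangles
  except $\sigma_5$, which is left to fix the commutators. The last equation serves the vertices, whose
  degenerate edges have to become trivial; its value at triangles is a dummy.
\<close>

fun cell_label :: "(torus_cell \<Rightarrow> bit) \<Rightarrow> torus_cell \<Rightarrow> bit \<times> bit \<times> bit \<times> bit \<times> bit" where
  "cell_label g ez1 = (0, 1, 0, 0, 0)"
| "cell_label g ez3 = (0, 0, 1, 0, 0)"
| "cell_label g ex = (0, 0, 0, 1, 0)"
| "cell_label g ey = (0, 0, 0, 0, 1)"
| "cell_label g et1 = (g sigma1, 1, 0, 1, 0)"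
| "cell_label g et2 = (g sigma3, 0, 1, 0, 1)"
| "cell_label g es1 = (g sigma4, 1, 0, 0, 1)"
| "cell_label g es2 = (g sigma6, 0, 1, 1, 0)"
| "cell_label g ez2 = (g sigma1 + g sigma2 + g sigma3, 1, 1, 1, 1)"
| "cell_label g c = (0, 0, 0, 0, 0)"

text \<open>Multiplication in \<open>square_group 0\<close> is the addition of vectors, so the fibre coordinate of an edge
  of the twisted product just adds to the exponent of \<open>J\<close>.\<close>

definition edge_label ::
    "(torus_cell \<Rightarrow> bit) \<Rightarrow> bit list \<times> torus_cell \<times> nat list \<Rightarrow> bit \<times> bit \<times> bit \<times> bit \<times> bit" where
  "edge_label g u = (hd (fst u), 0, 0, 0, 0) \<otimes>\<^bsub>square_group 0\<^esub> cell_label g (fst (snd u))"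

lemma cell_label_vertex: "cell_dim c = 0 \<Longrightarrow> cell_label g c = (0, 0, 0, 0, 0)"
  by (cases c) (auto simp: cell_dim_def)

lemma torus_class_expand:
  "torus_class \<gamma> = \<gamma> (nondeg sigma1) + \<gamma> (nondeg sigma2) + \<gamma> (nondeg sigma3)
     + \<gamma> (nondeg sigma4) + \<gamma> (nondeg sigma5) + \<gamma> (nondeg sigma6)"
  by (simp add: torus_class_def add_ac)

lemma edge_label_square:
  assumes "u \<in> simplices (twisted_product torus \<gamma>) 1"
  shows "edge_label g u \<otimes>\<^bsub>square_group c\<^esub> edge_label g u = \<one>\<^bsub>square_group c\<^esub>"
proof -
  obtain a e where "u = ([a], edge e)" using assms unfolding twisted_edges by blast
  then show ?thesis
    by (cases e) (simp_all add: edge_label_def bit_add_self)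
qed

lemma cell_dim_source_target:
  assumes "cell_dim c \<le> 1"
  shows "cell_dim (source c) = 0" "cell_dim (target c) = 0"
proof -
  have "cell_dim c = 0 \<or> cell_dim c = 1" using assms by linarith
  then show "cell_dim (source c) = 0" "cell_dim (target c) = 0"
    using cell_dim_source[of c] cell_dim_target[of c] by (auto simp: source_def target_def)
qed

lemma normalized_cocycle_degenerate:
  assumes "normalized_cocycle2 torus \<gamma>" "cell_dim c \<le> 1" "j \<le> 1"
  shows "\<gamma> (degen torus 1 j (edge c)) = 0"
  using assms torus_simplices1 unfolding normalized_cocycle2_def by blast

text \<open>The triangle $\sigma_5$ is where the class enters: the product of the labels of $s_1$ and $s_2$
  moves \<open>D\<close> past \<open>C\<close>, which contributes the sum of all values of \<open>\<gamma>\<close>.\<close>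

lemma edge_label_triangle:
  assumes \<gamma>: "normalized_cocycle2 torus \<gamma>"
    and \<rho>: "\<rho> \<in> simplices (twisted_product torus \<gamma>) 2"
  defines "f \<equiv> edge_label (\<lambda>c. \<gamma> (nondeg c))"
  shows "f (face (twisted_product torus \<gamma>) 2 2 \<rho>) \<otimes>\<^bsub>square_group (torus_class \<gamma>)\<^esub>
      f (face (twisted_product torus \<gamma>) 2 0 \<rho>) = f (face (twisted_product torus \<gamma>) 2 1 \<rho>)"
proof -
  obtain a b \<sigma> where \<rho>': "\<rho> = ([a, b], \<sigma>)" and \<sigma>: "\<sigma> \<in> simplices torus 2"
    using \<rho> unfolding twisted_triangles by blast
  from \<sigma> show ?thesis
  proof (cases rule: torus_triangle_cases)
    case (nondegenerate c)
    then have "c \<in> {sigma1, sigma2, sigma3, sigma4, sigma5, sigma6}"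
      by (cases c) (simp_all add: cell_dim_def)
    then show ?thesis
      using nondegenerate(1)
      by (auto simp: \<rho>' nondegenerate(2) twisted_triangle_faces nondeg_face f_def edge_label_def
          torus_class_expand bit_add_self add_ac simp del: One_nat_def)
  next
    case (left c)
    show ?thesis
      using left(1) cell_dim_source_target[OF left(1)] normalized_cocycle_degenerate[OF \<gamma> left(1)]
      by (cases "cell_label (\<lambda>c. \<gamma> (nondeg c)) c")
        (simp add: \<rho>' left(2) twisted_triangle_faces degen_edge_face f_def edge_label_def
          cell_label_vertex add_ac del: One_nat_def)
  next
    case (right c)
    show ?thesis
      using right(1) cell_dim_source_target[OF right(1)] normalized_cocycle_degenerate[OF \<gamma> right(1)]
      by (cases "cell_label (\<lambda>c. \<gamma> (nondeg c)) c")
        (simp add: \<rho>' right(2) twisted_triangle_faces degen_edge_face f_def edge_label_def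
          cell_label_vertex add_ac del: One_nat_def)
  qed
qed


section \<open>The fundamental group as the group of a Mermin square\<close>

text \<open>
  Degenerate triangles show that the edge generators over a vertex are $1$ and an involution \<open>J\<close>,
  that \<open>J\<close> is the same at both ends of an edge \<open>c\<close>, hence everywhere by connectedness, and that
  \<open>e a c\<close> is $J^a$ times \<open>e 0 c\<close>, with \<open>J\<close> central. The six nondegenerate triangles then are
  the lines of a Mermin square with entries \<open>e 0 c\<close>.
\<close>

lemma pi1_twisted_torus_square_generators:
  fixes \<gamma>
  assumes \<gamma>: "normalized_cocycle2 torus \<gamma>"
  defines "Y \<equiv> twisted_product torus \<gamma>"
  defines "e \<equiv> \<lambda>a c. pi1_gen Y ([a], edge c)"
  defines "g \<equiv> \<lambda>c. \<gamma> (nondeg c)"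
  shows "square_generators (pi1_Z2 Y) (e 1 vB) (e 0 ez1) (e 0 ez3) (e 0 ex) (e 0 ey) (torus_class \<gamma>)"
    and "u \<in> simplices Y 1 \<Longrightarrow> square_generators.normal_form (pi1_Z2 Y) (e 1 vB) (e 0 ez1) (e 0 ez3) (e 0 ex) (e 0 ey)
          (edge_label g u) = pi1_gen Y u"
proof -
  interpret group "pi1_Z2 Y" by (rule pi1_Z2_group)
  note One_nat_def [simp del]
  have mem: "([a], edge c) \<in> simplices Y 1" if "cell_dim c \<le> 1" for a c
    using that unfolding Y_def twisted_edges by blast
  have closed [simp]: "e a c \<in> carrier (pi1_Z2 Y)" if "cell_dim c \<le> 1" for a c
    unfolding e_def by (rule pi1_gen_carrier[OF mem[OF that]])
  have square: "e a c \<otimes>\<^bsub>pi1_Z2 Y\<^esub> e a c = \<one>\<^bsub>pi1_Z2 Y\<^esub>" if "cell_dim c \<le> 1" for a c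
    unfolding e_def by (rule pi1_gen_square[OF mem[OF that]])
  have triangle: "pi1_gen Y ([a], face torus 2 2 \<sigma>) \<otimes>\<^bsub>pi1_Z2 Y\<^esub> pi1_gen Y ([\<gamma> \<sigma> + b], face torus 2 0 \<sigma>)
      = pi1_gen Y ([a + b], face torus 2 1 \<sigma>)" if "\<sigma> \<in> simplices torus 2" for a b \<sigma>
  proof -
    have "([a, b], \<sigma>) \<in> simplices Y 2" using that unfolding Y_def twisted_triangles by blast
    from pi1_gen_face[OF this] show ?thesis
      using twisted_face_closed[of "([a, b], \<sigma>)" \<gamma>] \<open>([a, b], \<sigma>) \<in> simplices Y 2\<close>
      unfolding Y_def twisted_triangle_faces by blast
  qed
  have source: "e a (source c) \<otimes>\<^bsub>pi1_Z2 Y\<^esub> e b c = e (a + b) c" if "cell_dim c \<le> 1" for a b c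
    using triangle[of "degen torus 1 0 (edge c)" a b] torus_triangle_mem(2)[of c 0] that
      normalized_cocycle_degenerate[OF \<gamma> that, of 0]
    unfolding degen_edge_face[OF that] e_def by simp
  have target: "e a c \<otimes>\<^bsub>pi1_Z2 Y\<^esub> e b (target c) = e (a + b) c" if "cell_dim c \<le> 1" for a b c
    using triangle[of "degen torus 1 1 (edge c)" a b] torus_triangle_mem(2)[of c 1] that
      normalized_cocycle_degenerate[OF \<gamma> that, of 1]
    unfolding degen_edge_face[OF that] e_def by simp
  \<comment> \<open>Both \<open>e 1 (source c)\<close> and \<open>e 1 (target c)\<close> turn \<open>e 0 c\<close> into \<open>e 1 c\<close>, from opposite sides.\<close>
  have ends: "e 1 (source c) = e 1 (target c)" "e 1 (source c) \<otimes>\<^bsub>pi1_Z2 Y\<^esub> e 0 c = e 0 c \<otimes>\<^bsub>pi1_Z2 Y\<^esub> e 1 (source c)"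
    if c: "cell_dim c \<le> 1" for c
  proof -
    have cl [simp]: "cell_dim (source c) \<le> 1" "cell_dim (target c) \<le> 1"
      using cell_dim_source_target[OF c] by simp_all
    show comm: "e 1 (source c) \<otimes>\<^bsub>pi1_Z2 Y\<^esub> e 0 c = e 0 c \<otimes>\<^bsub>pi1_Z2 Y\<^esub> e 1 (source c)"
      using c square[of c 1] by (intro involutions_commute) (simp_all add: square source)
    have "e 0 c \<otimes>\<^bsub>pi1_Z2 Y\<^esub> e 1 (source c) = e 0 c \<otimes>\<^bsub>pi1_Z2 Y\<^esub> e 1 (target c)"
      unfolding comm[symmetric] using c by (simp add: source target)
    then show "e 1 (source c) = e 1 (target c)"
      using c by (simp add: Units_eq)
  qed
  have vertex_0: "e 0 v = \<one>\<^bsub>pi1_Z2 Y\<^esub>" if "cell_dim v = 0" for v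
    using source[of v 0 0] square[of v 0] that by (simp add: source_def)
  have "e 1 vA = e 1 vB" "e 1 vB = e 1 vC"
    using ends(1)[of ez1] ends(1)[of et2] by (simp_all add: cell_dim_def source_def target_def)
  then have vertex_1: "e 1 v = e 1 vB" if "cell_dim v = 0" for v
    using that by (cases v) (simp_all add: cell_dim_def)
  define K where "K = bit_pow (pi1_Z2 Y) (e 1 vB)"
  have vB: "cell_dim vB = 0" by (simp add: cell_dim_def)
  have vertex: "e a v = K a" if "cell_dim v = 0" for a v
    using vertex_0[OF that] vertex_1[OF that] by (cases a) (simp_all add: K_def)
  have [simp]: "K a \<in> carrier (pi1_Z2 Y)" for a using vB by (simp add: K_def)
  have KK: "K a \<otimes>\<^bsub>pi1_Z2 Y\<^esub> K b = K (a + b)" for a b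
    unfolding K_def using vB by (intro bit_pow_add square) simp_all
  have Ke: "e a c = K a \<otimes>\<^bsub>pi1_Z2 Y\<^esub> e 0 c" if "cell_dim c \<le> 1" for a c
    using source[OF that, of a 0] vertex[OF cell_dim_source_target(1)[OF that]] by simp
  have e_central: "e 0 c \<otimes>\<^bsub>pi1_Z2 Y\<^esub> e 1 vB = e 1 vB \<otimes>\<^bsub>pi1_Z2 Y\<^esub> e 0 c" if "cell_dim c \<le> 1" for c
    using ends(2)[OF that] vertex_1[OF cell_dim_source_target(1)[OF that]] by simp
  have nondeg: "K (g c) \<otimes>\<^bsub>pi1_Z2 Y\<^esub> (e 0 (cell_faces c ! 2) \<otimes>\<^bsub>pi1_Z2 Y\<^esub> e 0 (cell_faces c ! 0))
      = e 0 (cell_faces c ! 1)" if c: "cell_dim c = 2" for c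
  proof -
    have dim: "cell_dim (cell_faces c ! i) \<le> 1" if "i \<le> 2" for i
      using cell_dim_face[OF c that] by simp
    have "e 0 (cell_faces c ! 2) \<otimes>\<^bsub>pi1_Z2 Y\<^esub> e (g c) (cell_faces c ! 0) = e 0 (cell_faces c ! 1)"
      using triangle[OF torus_triangle_mem(1)[OF c], of 0 0] nondeg_face[OF c]
      by (simp add: e_def g_def)
    moreover have "e 0 (cell_faces c ! 2) \<otimes>\<^bsub>pi1_Z2 Y\<^esub> K (g c) = K (g c) \<otimes>\<^bsub>pi1_Z2 Y\<^esub> e 0 (cell_faces c ! 2)"
      using e_central[OF dim[of 2]] dim[of 2] by (cases "g c") (simp_all add: K_def)
    ultimately show ?thesis
      using dim[of 0] dim[of 2] by (simp add: Ke[of "cell_faces c ! 0" "g c"] m_assoc[symmetric])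
  qed
  note tri = nondeg[of sigma1] nondeg[of sigma2] nondeg[of sigma3]
    nondeg[of sigma4] nondeg[of sigma5] nondeg[of sigma6]
  have dims: "cell_dim ez1 \<le> 1" "cell_dim ez3 \<le> 1" "cell_dim ex \<le> 1" "cell_dim ey \<le> 1"
    "cell_dim et1 \<le> 1" "cell_dim et2 \<le> 1" "cell_dim es1 \<le> 1" "cell_dim es2 \<le> 1" "cell_dim ez2 \<le> 1"
    by (simp_all add: cell_dim_def)
  have tri:
    "K (g sigma1) \<otimes>\<^bsub>pi1_Z2 Y\<^esub> (e 0 ez1 \<otimes>\<^bsub>pi1_Z2 Y\<^esub> e 0 ex) = e 0 et1"
    "K (g sigma3) \<otimes>\<^bsub>pi1_Z2 Y\<^esub> (e 0 ey \<otimes>\<^bsub>pi1_Z2 Y\<^esub> e 0 ez3) = e 0 et2"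
    "K (g sigma5) \<otimes>\<^bsub>pi1_Z2 Y\<^esub> (e 0 es1 \<otimes>\<^bsub>pi1_Z2 Y\<^esub> e 0 es2) = e 0 ez2"
    "K (g sigma4) \<otimes>\<^bsub>pi1_Z2 Y\<^esub> (e 0 ez1 \<otimes>\<^bsub>pi1_Z2 Y\<^esub> e 0 ey) = e 0 es1"
    "K (g sigma6) \<otimes>\<^bsub>pi1_Z2 Y\<^esub> (e 0 ex \<otimes>\<^bsub>pi1_Z2 Y\<^esub> e 0 ez3) = e 0 es2"
    "K (g sigma2) \<otimes>\<^bsub>pi1_Z2 Y\<^esub> (e 0 et1 \<otimes>\<^bsub>pi1_Z2 Y\<^esub> e 0 et2) = e 0 ez2"
    using tri by (simp_all add: cell_dim_def)
  have JJ: "e 1 vB \<otimes>\<^bsub>pi1_Z2 Y\<^esub> e 1 vB = \<one>\<^bsub>pi1_Z2 Y\<^esub>" using square[of vB 1] vB by simp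
  have total: "torus_class \<gamma> = g sigma1 + g sigma2 + g sigma3 + g sigma4 + g sigma5 + g sigma6"
    by (simp add: torus_class_expand g_def)
  show gens: "square_generators (pi1_Z2 Y) (e 1 vB) (e 0 ez1) (e 0 ez3) (e 0 ex) (e 0 ey) (torus_class \<gamma>)"
    unfolding total
  proof (rule mermin_square[OF _ _ _ _ _ JJ _ _ tri[unfolded K_def]])
    show "x \<otimes>\<^bsub>pi1_Z2 Y\<^esub> e 1 vB = e 1 vB \<otimes>\<^bsub>pi1_Z2 Y\<^esub> x" if "x \<in> {e 0 ez1, e 0 ez3, e 0 ex, e 0 ey}" for x
      using that e_central dims by auto
    show "x \<otimes>\<^bsub>pi1_Z2 Y\<^esub> x = \<one>\<^bsub>pi1_Z2 Y\<^esub>"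
      if "x \<in> {e 0 ez1, e 0 ez3, e 0 ex, e 0 ey, e 0 et1, e 0 et2, e 0 es1, e 0 es2, e 0 ez2}" for x
      using that square dims by auto
  qed (use dims vB in simp_all)
  interpret square_generators "pi1_Z2 Y" "e 1 vB" "e 0 ez1" "e 0 ez3" "e 0 ex" "e 0 ey" "torus_class \<gamma>"
    by (rule gens)
  show "normal_form (edge_label g u) = pi1_gen Y u" if u_mem: "u \<in> simplices Y 1"
  proof -
    obtain a c where u: "u = ([a], edge c)" and c: "cell_dim c \<le> 1"
      using u_mem unfolding Y_def twisted_edges by blast
    have KK': "K a \<otimes>\<^bsub>pi1_Z2 Y\<^esub> (K b \<otimes>\<^bsub>pi1_Z2 Y\<^esub> x) = K (a + b) \<otimes>\<^bsub>pi1_Z2 Y\<^esub> x"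
      if "x \<in> carrier (pi1_Z2 Y)" for a b x
      using that by (simp add: m_assoc[symmetric] KK)
    have K_right: "e 0 c \<otimes>\<^bsub>pi1_Z2 Y\<^esub> (K b \<otimes>\<^bsub>pi1_Z2 Y\<^esub> x) = K b \<otimes>\<^bsub>pi1_Z2 Y\<^esub> (e 0 c \<otimes>\<^bsub>pi1_Z2 Y\<^esub> x)"
      if "cell_dim c \<le> 1" "x \<in> carrier (pi1_Z2 Y)" for c b x
      using that e_central[of c] vB by (cases b) (simp_all add: K_def m_assoc[symmetric])
    have cells: "c \<in> {vA, vB, vC, ez1, ez3, ex, ey, et1, et2, es1, es2, ez2}"
      using c by (cases c) (simp_all add: cell_dim_def)
    have DAB: "e 0 ey \<otimes>\<^bsub>pi1_Z2 Y\<^esub> e 0 ez3 = e 0 ez3 \<otimes>\<^bsub>pi1_Z2 Y\<^esub> e 0 ey"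
      "e 0 ex \<otimes>\<^bsub>pi1_Z2 Y\<^esub> e 0 ez3 = e 0 ez3 \<otimes>\<^bsub>pi1_Z2 Y\<^esub> e 0 ex"
      by (rule commute)+
    have "e 0 ex \<otimes>\<^bsub>pi1_Z2 Y\<^esub> (e 0 ez3 \<otimes>\<^bsub>pi1_Z2 Y\<^esub> e 0 ey) = e 0 ez3 \<otimes>\<^bsub>pi1_Z2 Y\<^esub> (e 0 ex \<otimes>\<^bsub>pi1_Z2 Y\<^esub> e 0 ey)"
      using dims DAB by (simp add: m_assoc[symmetric])
    then have z2: "e 0 ez2 = K (g sigma1 + g sigma2 + g sigma3) \<otimes>\<^bsub>pi1_Z2 Y\<^esub>
        (e 0 ez1 \<otimes>\<^bsub>pi1_Z2 Y\<^esub> (e 0 ez3 \<otimes>\<^bsub>pi1_Z2 Y\<^esub> (e 0 ex \<otimes>\<^bsub>pi1_Z2 Y\<^esub> e 0 ey)))"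
      using dims unfolding tri(6)[symmetric] tri(1,2)[symmetric] DAB
      by (simp add: m_assoc K_right KK' add_ac)
    have "normal_form (edge_label g ([a], edge c)) = K a \<otimes>\<^bsub>pi1_Z2 Y\<^esub> e 0 c"
      using cells dims
      by (auto simp: edge_label_def normal_form_def K_def[symmetric] z2 tri(1,2,4,5)[symmetric] DAB
          vertex_0 cell_dim_def KK')
    also have "\<dots> = pi1_gen Y u" unfolding Ke[OF c, of a, symmetric] by (simp only: u e_def)
    finally show ?thesis unfolding u .
  qed
qed

text \<open>
  The edge labels satisfy the relations of \<open>pi1_Z2\<close>, and the edge generators those of
  \<open>square_group\<close>; the two homomorphisms obtained are inverse to each other on generators. The first
  one is what shows that \<open>pi1_Z2\<close> does not collapse any further.
\<close>

theorem pi1_twisted_torus_iso: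
  assumes \<gamma>: "normalized_cocycle2 torus \<gamma>"
  shows "pi1_Z2 (twisted_product torus \<gamma>) \<cong> square_group (torus_class \<gamma>)"
proof -
  define Y where "Y = twisted_product torus \<gamma>"
  define e where "e = (\<lambda>a c. pi1_gen Y ([a], edge c))"
  define g where "g = (\<lambda>c. \<gamma> (nondeg c))"
  let ?P = "square_group (torus_class \<gamma>)"
  interpret square_generators "pi1_Z2 Y" "e 1 vB" "e 0 ez1" "e 0 ez3" "e 0 ex" "e 0 ey" "torus_class \<gamma>"
    unfolding e_def Y_def by (rule pi1_twisted_torus_square_generators(1)[OF \<gamma>])
  interpret P: group ?P by (rule square_group_group)
  have normal_form_label: "normal_form (edge_label g u) = pi1_gen Y u" if "u \<in> simplices Y 1" for u
    using pi1_twisted_torus_square_generators(2)[OF \<gamma>] that unfolding e_def Y_def g_def by blast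
  obtain h where h: "h \<in> hom (pi1_Z2 Y) ?P"
    and h_gen: "\<And>u. u \<in> simplices Y 1 \<Longrightarrow> h (pi1_gen Y u) = edge_label g u"
  proof (atomize_elim, rule P.pi1_Z2_hom[of Y "edge_label g"])
    show "face Y 2 i \<sigma> \<in> simplices Y 1" if "\<sigma> \<in> simplices Y 2" "i \<le> 2" for \<sigma> i
      using that twisted_face_closed unfolding Y_def by blast
    show "edge_label g u \<otimes>\<^bsub>?P\<^esub> edge_label g u = \<one>\<^bsub>?P\<^esub>" if "u \<in> simplices Y 1" for u
      using that edge_label_square unfolding Y_def by blast
    show "edge_label g (face Y 2 2 \<sigma>) \<otimes>\<^bsub>?P\<^esub> edge_label g (face Y 2 0 \<sigma>) = edge_label g (face Y 2 1 \<sigma>)"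
      if "\<sigma> \<in> simplices Y 2" for \<sigma>
      using that edge_label_triangle[OF \<gamma>] unfolding Y_def g_def by blast
    show "\<exists>h. h \<in> hom (pi1_Z2 Y) ?P \<and> (\<forall>u. u \<in> simplices Y 1 \<longrightarrow> h (pi1_gen Y u) = edge_label g u)"
      if "k \<in> hom (pi1_Z2 Y) ?P" "\<And>u. u \<in> simplices Y 1 \<Longrightarrow> k (pi1_gen Y u) = edge_label g u" for k
      using that by blast
  qed simp
  have left: "normal_form (h x) = x" if "x \<in> carrier (pi1_Z2 Y)" for x
  proof -
    have "(\<lambda>x. normal_form (h x)) \<in> hom (pi1_Z2 Y) (pi1_Z2 Y)"
      using Group.hom_compose[OF h normal_form_hom] by (simp add: comp_def)
    moreover have "(\<lambda>x. x) \<in> hom (pi1_Z2 Y) (pi1_Z2 Y)"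
      by (simp add: hom_def)
    ultimately show ?thesis
      by (rule pi1_Z2_hom_ext[OF is_group]) (simp_all add: h_gen normal_form_label that del: One_nat_def)
  qed
  have right: "h (normal_form v) = v" for v
  proof -
    interpret h: group_hom "pi1_Z2 Y" ?P h
      using h by unfold_locales
    have mem: "([a], edge c) \<in> simplices Y 1" if "cell_dim c \<le> 1" for a c
      using that unfolding Y_def twisted_edges by blast
    have pow: "h (bit_pow (pi1_Z2 Y) x b) = bit_pow ?P (h x) b" for x b
      by (cases b) simp_all
    have "h (e 1 vB) = (1, 0, 0, 0, 0)" "h (e 0 ez1) = (0, 1, 0, 0, 0)" "h (e 0 ez3) = (0, 0, 1, 0, 0)"
      "h (e 0 ex) = (0, 0, 0, 1, 0)" "h (e 0 ey) = (0, 0, 0, 0, 1)"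
      by (simp_all add: e_def h_gen mem cell_dim_def edge_label_def del: One_nat_def)
    moreover obtain j p q r s where v: "v = (j, p, q, r, s)" by (cases v)
    ultimately have "h (normal_form v) = bit_pow ?P (1, 0, 0, 0, 0) j \<otimes>\<^bsub>?P\<^esub> (bit_pow ?P (0, 1, 0, 0, 0) p \<otimes>\<^bsub>?P\<^esub>
       (bit_pow ?P (0, 0, 1, 0, 0) q \<otimes>\<^bsub>?P\<^esub> (bit_pow ?P (0, 0, 0, 1, 0) r \<otimes>\<^bsub>?P\<^esub> bit_pow ?P (0, 0, 0, 0, 1) s)))"
      using closed by (simp add: normal_form_def pow)
    also have "\<dots> = v"
      unfolding v by (cases j; cases p; cases q; cases r; cases s) simp_all
    finally show ?thesis .
  qed
  have "bij_betw h (carrier (pi1_Z2 Y)) (carrier ?P)"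
    using left right h normal_form_hom
    by (intro bij_betw_byWitness[where f' = normal_form]) (auto simp: hom_def)
  then show ?thesis
    using h unfolding is_iso_def iso_def Y_def by blast
qed


section \<open>Identification with the elementary abelian group and the central product\<close>

lemma square_group_0_iso:
  "square_group 0 \<cong> product_group {..<5::nat} (\<lambda>_. integer_mod_group 2)"
proof -
  define to_int where "to_int b = (if b = 0 then 0 else 1 :: int)" for b :: bit
  define to_fun where "to_fun = (\<lambda>(j, p, q, r, s). \<lambda>i\<in>{..<5::nat}. to_int ([j, p, q, r, s] ! i))"
  define from_fun :: "(nat \<Rightarrow> int) \<Rightarrow> bit \<times> bit \<times> bit \<times> bit \<times> bit"
    where "from_fun x = (of_int (x 0), of_int (x 1), of_int (x 2), of_int (x 3), of_int (x 4))" for x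
  let ?Q = "product_group {..<5::nat} (\<lambda>_. integer_mod_group 2)"
  have less_5: "i = 0 \<or> i = 1 \<or> i = 2 \<or> i = 3 \<or> i = 4" if "i < 5" for i :: nat
    using that by linarith
  have to_int_add: "to_int (a + b) = (to_int a + to_int b) mod 2" for a b
    by (cases a; cases b) (simp_all add: to_int_def)
  have of_to: "of_int (to_int b) = b" for b :: bit
    by (cases b) (simp_all add: to_int_def)
  have to_of: "to_int (of_int n) = n" if "n \<in> {0..<2}" for n
  proof -
    have "n = 0 \<or> n = 1" using that by auto
    then show ?thesis by (auto simp: to_int_def)
  qed
  have "to_fun \<in> hom (square_group 0) ?Q"
  proof (rule homI)
    fix u v :: "bit \<times> bit \<times> bit \<times> bit \<times> bit"
    obtain j p q r s j' p' q' r' s' where uv: "u = (j, p, q, r, s)" "v = (j', p', q', r', s')"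
      by (cases u, cases v)
    show "to_fun u \<in> carrier ?Q"
      by (auto simp: to_fun_def uv to_int_def integer_mod_group_def)
    show "to_fun (u \<otimes>\<^bsub>square_group 0\<^esub> v) = to_fun u \<otimes>\<^bsub>?Q\<^esub> to_fun v"
      by (rule ext) (auto simp: to_fun_def uv to_int_add integer_mod_group_def dest!: less_5)
  qed
  moreover have "bij_betw to_fun (carrier (square_group 0)) (carrier ?Q)"
  proof (rule bij_betw_byWitness[where f' = from_fun])
    show "\<forall>u\<in>carrier (square_group 0). from_fun (to_fun u) = u"
      by (auto simp: from_fun_def to_fun_def of_to)
    show "\<forall>x\<in>carrier ?Q. to_fun (from_fun x) = x"
    proof
      fix x assume x: "x \<in> carrier ?Q"
      then have "to_int (of_int (x i)) = x i" if "i < 5" for i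
        using that by (intro to_of) (auto simp: integer_mod_group_def PiE_iff)
      then show "to_fun (from_fun x) = x"
        using x by (intro ext) (auto simp: to_fun_def from_fun_def PiE_iff extensional_def dest!: less_5)
    qed
    show "to_fun ` carrier (square_group 0) \<subseteq> carrier ?Q"
      using \<open>to_fun \<in> hom (square_group 0) ?Q\<close> by (auto simp: hom_def)
  qed auto
  ultimately show ?thesis unfolding is_iso_def iso_def by blast
qed

lemma dihedral_group_simps [simp]:
  "carrier (dihedral_group n) = {0..<int n} \<times> UNIV"
  "(a, e) \<otimes>\<^bsub>dihedral_group n\<^esub> (b, f) = ((if e = 0 then a + b else a - b) mod int n, e + f)"
  "\<one>\<^bsub>dihedral_group n\<^esub> = (0, 0)"
  by (simp_all add: dihedral_group_def)

lemma dihedral_group_group: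
  assumes "0 < n"
  shows "group (dihedral_group n)"
proof (rule groupI)
  fix x y z
  assume "x \<in> carrier (dihedral_group n)" "y \<in> carrier (dihedral_group n)" "z \<in> carrier (dihedral_group n)"
  obtain a e b f c g where xyz: "x = (a, e)" "y = (b, f)" "z = (c, g)" by (cases x, cases y, cases z)
  show "x \<otimes>\<^bsub>dihedral_group n\<^esub> y \<otimes>\<^bsub>dihedral_group n\<^esub> z
      = x \<otimes>\<^bsub>dihedral_group n\<^esub> (y \<otimes>\<^bsub>dihedral_group n\<^esub> z)"
    unfolding xyz by (cases e; cases f) (simp_all add: mod_simps algebra_simps)
next
  fix x assume x: "x \<in> carrier (dihedral_group n)"
  obtain a e where ae: "x = (a, e)" by (cases x)
  have "((if e = 0 then - a else a) mod int n, e) \<otimes>\<^bsub>dihedral_group n\<^esub> x = \<one>\<^bsub>dihedral_group n\<^esub>"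
    by (cases e) (simp_all add: ae mod_simps)
  moreover have "((if e = 0 then - a else a) mod int n, e) \<in> carrier (dihedral_group n)"
    using assms by simp
  ultimately show "\<exists>y\<in>carrier (dihedral_group n). y \<otimes>\<^bsub>dihedral_group n\<^esub> x = \<one>\<^bsub>dihedral_group n\<^esub>"
    by blast
qed (use assms in \<open>auto split: prod.splits\<close>)

lemma dihedral_group_4_carrier: "carrier (dihedral_group 4) = {0, 1, 2, 3} \<times> {0, 1}"
proof -
  have "{0..<4::int} = {0, 1, 2, 3}" by auto
  moreover have "(UNIV :: bit set) = {0, 1}" by (auto intro: bit.exhaust)
  ultimately show ?thesis by simp
qed

lemma center_dihedral_group_4: "group_center (dihedral_group 4) = {(0, 0), (2, 0)}"
  unfolding group_center_def dihedral_group_4_carrier by auto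

text \<open>With $r = AB$ and $s = B$, the rotation $r$ has square \<open>J\<close>, so $r^a s^e$ is
  $J^{a\,\mathrm{div}\,2} A^a B^{a+e}$; these are the exponents of \<open>J\<close>, \<open>A\<close>, \<open>B\<close>.\<close>

definition dihedral_coords :: "int \<times> bit \<Rightarrow> bit \<times> bit \<times> bit" where
  "dihedral_coords = (\<lambda>(a, e). (of_int (a div 2), of_int a, of_int a + e))"

lemma dihedral_coords_mult:
  assumes "x \<in> carrier (dihedral_group 4)" "y \<in> carrier (dihedral_group 4)"
    and "dihedral_coords x = (j, p, q)" "dihedral_coords y = (j', p', q')"
  shows "dihedral_coords (x \<otimes>\<^bsub>dihedral_group 4\<^esub> y) = (j + j' + q * p', p + p', q + q')"
  using assms unfolding dihedral_group_4_carrier dihedral_coords_def by auto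

text \<open>The two factors are sent to the subgroups generated by \<open>A\<close>, \<open>B\<close> and by \<open>C\<close>, \<open>D\<close>. These
  commute and meet in $\{1, J\}$, the common image of the two centers, so the kernel consists of the
  pairs $(z, z^{-1})$ with \<open>z\<close> central.\<close>

lemma square_group_1_iso:
  "square_group 1 \<cong> central_product (dihedral_group 4) (dihedral_group 4) id"
proof -
  let ?D = "dihedral_group 4"
  define h where "h = (\<lambda>(x, y). case (dihedral_coords x, dihedral_coords y) of
    ((j, p, q), (j', r, s)) \<Rightarrow> (j + j', p, q, r, s))"
  interpret D: group ?D by (rule dihedral_group_group) simp
  interpret P: group "square_group 1" by (rule square_group_group)
  interpret DD: group "?D \<times>\<times> ?D" by (rule DirProd_group) (rule D.is_group)+
  interpret h: group_hom "?D \<times>\<times> ?D" "square_group 1" h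
  proof unfold_locales
    show "h \<in> hom (?D \<times>\<times> ?D) (square_group 1)"
    proof (rule homI)
      fix u v assume uv: "u \<in> carrier (?D \<times>\<times> ?D)" "v \<in> carrier (?D \<times>\<times> ?D)"
      obtain x y x' y' where xy: "u = (x, y)" "v = (x', y')" by (cases u, cases v)
      obtain j p q j' p' q' where c: "dihedral_coords x = (j, p, q)" "dihedral_coords x' = (j', p', q')"
        using prod_cases3 by metis
      obtain k r s k' r' s' where d: "dihedral_coords y = (k, r, s)" "dihedral_coords y' = (k', r', s')"
        using prod_cases3 by metis
      have "dihedral_coords (x \<otimes>\<^bsub>?D\<^esub> x') = (j + j' + q * p', p + p', q + q')"
        "dihedral_coords (y \<otimes>\<^bsub>?D\<^esub> y') = (k + k' + s * r', r + r', s + s')"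
        using uv xy c d by (auto intro!: dihedral_coords_mult simp del: dihedral_group_simps)
      then show "h (u \<otimes>\<^bsub>?D \<times>\<times> ?D\<^esub> v) = h u \<otimes>\<^bsub>square_group 1\<^esub> h v"
        by (simp add: h_def xy c d add_ac del: dihedral_group_simps)
    qed simp
  qed
  have "h ` carrier (?D \<times>\<times> ?D) = UNIV"
  proof -
    have "v \<in> h ` carrier (?D \<times>\<times> ?D)" for v
    proof -
      obtain j p q r s where v: "v = (j, p, q, r, s)" by (cases v)
      define to_int where "to_int b = (if b = 0 then 0 else 1 :: int)" for b :: bit
      have "h ((2 * to_int j + to_int p, p + q), (to_int r, r + s)) = v"
        by (cases j; cases p; cases r) (simp_all add: v h_def dihedral_coords_def to_int_def bit_add_self)
      moreover have "((2 * to_int j + to_int p, p + q), (to_int r, r + s)) \<in> carrier (?D \<times>\<times> ?D)"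
        by (simp add: to_int_def)
      ultimately show ?thesis by (metis imageI)
    qed
    then show ?thesis by blast
  qed
  moreover have ker: "kernel (?D \<times>\<times> ?D) (square_group 1) h = (\<lambda>z. (z, inv\<^bsub>?D\<^esub> (id z))) ` group_center ?D"
  proof -
    have "inv\<^bsub>?D\<^esub> (0, 0) = (0, 0)" "inv\<^bsub>?D\<^esub> (2, 0) = (2, 0)"
      by (intro D.inv_equality; simp)+
    then have "(\<lambda>z. (z, inv\<^bsub>?D\<^esub> (id z))) ` group_center ?D = {((0, 0), (0, 0)), ((2, 0), (2, 0))}"
      by (simp add: center_dihedral_group_4)
    moreover have "kernel (?D \<times>\<times> ?D) (square_group 1) h = {((0, 0), (0, 0)), ((2, 0), (2, 0))}"
      unfolding kernel_def DirProd_def h_def dihedral_coords_def partial_object.simps dihedral_group_4_carrier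
      by auto
    ultimately show ?thesis by simp
  qed
  ultimately have "central_product ?D ?D id \<cong> square_group 1"
    using h.FactGroup_iso unfolding central_product_def by simp
  moreover have "group (central_product ?D ?D id)"
    using normal.factorgroup_is_group[OF h.normal_kernel] ker unfolding central_product_def by simp
  ultimately show ?thesis by (rule group.iso_sym[rotated])
qed


theorem proposition3p26:
  fixes \<gamma> :: "torus_cell \<times> nat list \<Rightarrow> bit"
  assumes "normalized_cocycle2 torus \<gamma>"
  shows "(torus_class \<gamma> = 0 \<longrightarrow>
            pi1_Z2 (twisted_product torus \<gamma>)
              \<cong> product_group {..<5::nat} (\<lambda>_. integer_mod_group 2))
       \<and> (torus_class \<gamma> = 1 \<longrightarrow>
            pi1_Z2 (twisted_product torus \<gamma>)
              \<cong> central_product (dihedral_group 4) (dihedral_group 4) id)"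
  using pi1_twisted_torus_iso[OF assms] square_group_0_iso square_group_1_iso iso_trans by metis

end
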